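(* If $GL=L(G;a_1,\dots,a_n)$ is a connected non-trivially Hoffman colorable generalized line graph with $\lambda_{\min}(GL)>-2$, then $a_1=\dots=a_n=0$, so $GL$ is a line graph. In particular, up to isomorphism, the graph $F$ is the unique connected non-trivially Hoffman colorable generalized line graph with $\lambda_{\min}>-2$.
   Context: Graphs are finite and simple; $\lambda_{\max},\lambda_{\min}$ are the largest/smallest adjacency eigenvalues. A graph $G$ with an edge is Hoffman colorable if $\chi(G)=1-\lambda_{\max}(G)/\lambda_{\min}(G)$, and non-trivially Hoffman colorable if moreover it is not bipartite and not a complete multipartite graph $K_{m,\dots,m}$ with equal part sizes. $CP(m)$ is the complete multipartite graph with $m$ parts of size $2$. For a graph $G$ with vertices $v_1,\dots,v_n$ and nonnegative integers $a_i$, $L(G;a_1,\dots,a_n)$ is obtained from the disjoint union of the line graph $L(G)$ and $CP(a_1),\dots,CP(a_n)$ by joining every vertex of the $i$-th cocktail party graph to every vertex of $L(G)$ that is an edge of $G$ incident with $v_i$; generalized line graphs are graphs isomorphic to such graphs. $F$ is the graph on $\{1,\dots,6\}$ with edges $\{1,4\},\{1,5\},\{2,4\},\{2,6\},\{3,5\},\{3,6\},\{4,5\},\{4,6\},\{5,6\}$. *)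

theory Defs
  imports "Graph_Theory.Graph_Theory" "Jordan_Normal_Form.Char_Poly"
begin

text \<open>
  A finite simple graph is a \<open>pair_graph\<close> of Graph\_Theory: finite, loop-free, with a symmetric
  set of arcs, so that an undirected edge \<open>{u, v}\<close> is the pair of arcs \<open>(u, v)\<close>, \<open>(v, u)\<close>.
  Connectedness and isomorphism are \<open>Digraph_Component.connected\<close> (which requires at least
  one vertex) and \<open>digraph_iso\<close>, applied to \<open>with_proj G\<close>.
\<close>

definition edges :: "'a pair_pre_digraph \<Rightarrow> 'a set set" where
  "edges G = {{u, v} | u v. (u, v) \<in> parcs G}"


subsection \<open>Adjacency eigenvalues\<close>

definition adjacency_mat :: "'a pair_pre_digraph \<Rightarrow> 'a list \<Rightarrow> real mat" where
  "adjacency_mat G vs =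
     mat (length vs) (length vs) (\<lambda>(i, j). of_bool ((vs ! i, vs ! j) \<in> parcs G))"

text \<open>
  The matrices for two orderings of the vertices are conjugate by a permutation matrix, so the
  choice of the enumeration \<open>vs\<close> is immaterial. For a symmetric arc set the matrix is
  symmetric, hence all its eigenvalues are real.
\<close>

definition adjacency_eigenvalues :: "'a pair_pre_digraph \<Rightarrow> real set" where
  "adjacency_eigenvalues G =
     {k. \<exists>vs. distinct vs \<and> set vs = pverts G \<and> eigenvalue (adjacency_mat G vs) k}"

definition lambda_max :: "'a pair_pre_digraph \<Rightarrow> real" where
  "lambda_max G = Max (adjacency_eigenvalues G)"

definition lambda_min :: "'a pair_pre_digraph \<Rightarrow> real" where
  "lambda_min G = Min (adjacency_eigenvalues G)"


subsection \<open>Hoffman colorability\<close>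

definition proper_coloring :: "'a pair_pre_digraph \<Rightarrow> nat \<Rightarrow> ('a \<Rightarrow> nat) \<Rightarrow> bool" where
  "proper_coloring G k c \<longleftrightarrow>
     (\<forall>v \<in> pverts G. c v < k) \<and> (\<forall>(u, v) \<in> parcs G. c u \<noteq> c v)"

definition chromatic_number :: "'a pair_pre_digraph \<Rightarrow> nat" where
  "chromatic_number G = (LEAST k. \<exists>c. proper_coloring G k c)"

definition bipartite :: "'a pair_pre_digraph \<Rightarrow> bool" where
  "bipartite G \<longleftrightarrow>
     (\<exists>A B. pverts G = A \<union> B \<and> A \<inter> B = {} \<and> parcs G \<subseteq> A \<times> B \<union> B \<times> A)"

text \<open>\<open>K\<^bsub>m,\<dots>,m\<^esub>\<close> with \<open>k\<close> parts; the first component of a vertex is its part.\<close>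

definition equal_multipartite :: "nat \<Rightarrow> nat \<Rightarrow> (nat \<times> nat) pair_pre_digraph" where
  "equal_multipartite k m =
     \<lparr> pverts = {..<k} \<times> {..<m},
       parcs = {(x, y). x \<in> {..<k} \<times> {..<m} \<and> y \<in> {..<k} \<times> {..<m} \<and> fst x \<noteq> fst y} \<rparr>"

definition hoffman_colorable :: "'a pair_pre_digraph \<Rightarrow> bool" where
  "hoffman_colorable G \<longleftrightarrow>
     parcs G \<noteq> {} \<and> real (chromatic_number G) = 1 - lambda_max G / lambda_min G"

definition nontrivially_hoffman_colorable :: "'a pair_pre_digraph \<Rightarrow> bool" where
  "nontrivially_hoffman_colorable G \<longleftrightarrow>
     hoffman_colorable G \<and> \<not> bipartite G \<and>
     (\<forall>k m. \<not> digraph_iso (with_proj (equal_multipartite k m)) (with_proj G))"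


subsection \<open>Generalized line graphs\<close>

definition line_graph :: "'a pair_pre_digraph \<Rightarrow> 'a set pair_pre_digraph" where
  "line_graph G =
     \<lparr> pverts = edges G,
       parcs = {(e, f). e \<in> edges G \<and> f \<in> edges G \<and> e \<noteq> f \<and> e \<inter> f \<noteq> {}} \<rparr>"

definition cocktail_party :: "nat \<Rightarrow> (nat \<times> nat) pair_pre_digraph" where
  "cocktail_party m = equal_multipartite m 2"

text \<open>
  The sequence \<open>a\<^sub>1, \<dots>, a\<^sub>n\<close> is a function on the vertices of \<open>G\<close>. \<open>Inl e\<close> is the vertex \<open>e\<close> of
  the line graph and \<open>Inr (v, x)\<close> the vertex \<open>x\<close> of the cocktail party graph belonging to \<open>v\<close>.
\<close>

definition gen_line_graph ::
    "'a pair_pre_digraph \<Rightarrow> ('a \<Rightarrow> nat) \<Rightarrow> ('a set + 'a \<times> nat \<times> nat) pair_pre_digraph" where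
  "gen_line_graph G a =
     (let joins = {(Inl e, Inr (v, x)) | e v x.
                     e \<in> edges G \<and> v \<in> pverts G \<and> v \<in> e \<and> x \<in> pverts (cocktail_party (a v))}
      in \<lparr> pverts = Inl ` pverts (line_graph G) \<union>
                    Inr ` (SIGMA v : pverts G. pverts (cocktail_party (a v))),
           parcs = {(Inl e, Inl f) | e f. (e, f) \<in> parcs (line_graph G)} \<union>
                   {(Inr (v, x), Inr (v, y)) | v x y.
                      v \<in> pverts G \<and> (x, y) \<in> parcs (cocktail_party (a v))} \<union>
                   joins \<union> joins\<inverse> \<rparr>)"

text \<open>Every finite graph has an isomorphic copy on natural numbers, so root graphs \<open>H\<close> with
  vertices in \<open>nat\<close> yield all generalized line graphs up to isomorphism.\<close>

definition generalized_line_graph :: "'b pair_pre_digraph \<Rightarrow> bool" where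
  "generalized_line_graph X \<longleftrightarrow>
     pair_graph X \<and>
     (\<exists>(H :: nat pair_pre_digraph) a.
        pair_graph H \<and> digraph_iso (with_proj (gen_line_graph H a)) (with_proj X))"


subsection \<open>The graph F\<close>

definition graph_F :: "nat pair_pre_digraph" where
  "graph_F =
     (let E = {(1,4), (1,5), (2,4), (2,6), (3,5), (3,6), (4,5), (4,6), (5,6)}
      in \<lparr> pverts = {1..6}, parcs = E \<union> E\<inverse> \<rparr>)"

end

(*
  Let mu = - lambda_min. Equality in Hoffman's bound forces a positive weight x (the Perron vector)
  such that for every vertex v and every color i other than that of v, the neighbors of v of
  color i have total weight mu * x v. If mu <= 1 the graph is complete, so 1 < mu < 2 and there
  are at least three colors.

  In a generalized line graph all edges at a root vertex have different colors, so these local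
  conditions are very restrictive: there is at most one petal per root vertex, a petal needs root
  degree at least 2, and the neighbor of a leaf has no petal, no second leaf and degree at least the
  number of colors. On the other hand mu < 2 bounds the number of edges and petals by the number of
  root vertices. Comparing the two shows that there are no petals, that there are three colors, and
  that the root vertices of degree at least 3 are exactly the neighbors of leaves, of degree 3.

  An edge of maximal weight meets every color at both ends, so both ends support a leaf, and the
  third edge at each end again has maximal weight; moreover mu^2 = mu + 1. Finally the edges of
  maximal weight form a triangle, as four of them cannot form an induced path. The root graph is
  thus a triangle with a pendant edge at each vertex, whose line graph is F.
*)
theory Submission
  imports Defs "HOL-Analysis.Function_Topology"
begin

section \<open>Spectra of finite graphs\<close>

text \<open>The spectral input is that the form of A + mu I is nonnegative and that its null vectors
  lie in its kernel, so each spectral step is a test vector. With x_i the restriction of x to color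
  i, the values of the form at x - k x_i add up to zero over the k colors, so every x - k x_i is in
  the kernel; read at a vertex of another color, this is the local weight condition. The vector (1,
  -1, 1) on an induced path of three vertices excludes mu \<le> 1. A kernel vector of the incidence
  matrix, which would exist if edges and petals outnumbered the non-isolated root vertices, gives
  the value (mu - 2) |f|^2 < 0. The local conditions only give lower bounds on root degrees; this
  count bounds their average and leaves no slack. The equation mu^2 = mu + 1 comes from the four
  neighbors of a maximal edge: the two heavy ones get different colors because mu \<noteq> 2. For mu
  > 0 it is also exactly the condition that makes (1, -mu, mu, -1) null on an induced path of four
  vertices.\<close>

lemma digraph_iso_pairE:
  assumes "digraph_iso (with_proj G) (with_proj H)"
  obtains h where "bij_betw h (pverts G) (pverts H)"
    "\<And>u v. u \<in> pverts G \<Longrightarrow> v \<in> pverts G \<Longrightarrow> (h u, h v) \<in> parcs H \<longleftrightarrow> (u, v) \<in> parcs G"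
proof -
  obtain f where f: "pre_digraph.digraph_isomorphism (with_proj G) f"
    "with_proj H = app_iso f (with_proj G)"
    using assms unfolding digraph_iso_def by blast
  define h where "h = iso_verts f"
  have inj: "inj_on h (pverts G)" and wf: "wf_digraph (with_proj G)"
    using f(1) unfolding pre_digraph.digraph_isomorphism_def h_def by auto
  have V: "pverts H = h ` pverts G"
    using arg_cong[OF f(2), of verts] by (simp add: h_def)
  have A: "parcs H = iso_arcs f ` parcs G"
    using arg_cong[OF f(2), of arcs] by simp
  have T: "iso_tail f = fst" "iso_head f = snd"
    using arg_cong[OF f(2), of tail] arg_cong[OF f(2), of head] by simp_all
  \<comment> \<open>Tail and head of pair digraphs are \<open>fst\<close> and \<open>snd\<close>, so
    compatibility with them leaves no freedom in the arc map.\<close>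
  have arc: "iso_arcs f (u, v) = (h u, h v)" if "(u, v) \<in> parcs G" for u v
    using f(1) that T unfolding pre_digraph.digraph_isomorphism_def h_def
    by (force simp: prod_eq_iff)
  have A': "parcs H = (\<lambda>(u, v). (h u, h v)) ` parcs G"
    unfolding A by (rule image_cong) (auto simp: arc)
  have in_verts: "u \<in> pverts G" "v \<in> pverts G" if "(u, v) \<in> parcs G" for u v
    using wf_digraph.tail_in_verts[OF wf, of "(u, v)"] wf_digraph.head_in_verts[OF wf, of "(u, v)"] that
    by simp_all
  show thesis
  proof
    show "bij_betw h (pverts G) (pverts H)"
      using inj V by (simp add: bij_betw_def)
    show "(h u, h v) \<in> parcs H \<longleftrightarrow> (u, v) \<in> parcs G"
      if "u \<in> pverts G" "v \<in> pverts G" for u v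
    proof
      assume "(h u, h v) \<in> parcs H"
      then obtain a b where "(a, b) \<in> parcs G" "h u = h a" "h v = h b" unfolding A' by auto
      with inj that in_verts show "(u, v) \<in> parcs G" by (metis inj_onD)
    qed (auto simp: A')
  qed
qed

lemma digraph_iso_pairI:
  assumes G: "pair_wf_digraph G" and H: "pair_wf_digraph H"
    and bij: "bij_betw h (pverts G) (pverts H)"
    and adj: "\<And>u v. u \<in> pverts G \<Longrightarrow> v \<in> pverts G \<Longrightarrow> (h u, h v) \<in> parcs H \<longleftrightarrow> (u, v) \<in> parcs G"
  shows "digraph_iso (with_proj G) (with_proj H)"
proof -
  interpret G: pair_wf_digraph G by (rule G)
  interpret H: pair_wf_digraph H by (rule H)
  define f where "f = \<lparr>iso_verts = h, iso_arcs = map_prod h h, iso_head = snd, iso_tail = fst\<rparr>"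
  have inj: "inj_on h (pverts G)" and V: "pverts H = h ` pverts G"
    using bij by (auto simp: bij_betw_def)
  have arcs: "parcs G \<subseteq> pverts G \<times> pverts G"
    using G.in_arcsD1 G.in_arcsD2 by auto
  have "pre_digraph.digraph_isomorphism (with_proj G) f"
    unfolding pre_digraph.digraph_isomorphism_def f_def
    using G.wf_digraph_axioms inj inj_on_subset[OF map_prod_inj_on[OF inj inj] arcs]
    by auto
  moreover have "parcs H = map_prod h h ` parcs G"
  proof
    show "parcs H \<subseteq> map_prod h h ` parcs G"
    proof clarify
      fix u v assume uv: "(u, v) \<in> parcs H"
      then obtain u' v' where "u' \<in> pverts G" "v' \<in> pverts G" "u = h u'" "v = h v'"
        using V H.in_arcsD1 H.in_arcsD2 by blast
      with uv adj show "(u, v) \<in> map_prod h h ` parcs G" by force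
    qed
    show "map_prod h h ` parcs G \<subseteq> parcs H"
      using adj by (auto dest: G.in_arcsD1 G.in_arcsD2)
  qed
  then have "with_proj H = app_iso f (with_proj G)"
    using V by (simp add: app_iso_def f_def with_proj_def)
  ultimately show ?thesis unfolding digraph_iso_def by blast
qed

definition nbrs :: "'a pair_pre_digraph \<Rightarrow> 'a \<Rightarrow> 'a set" where
  "nbrs G v = {u. (v, u) \<in> parcs G}"

text \<open>Taking \<open>s = 1\<close> and \<open>s = -1\<close> treats the smallest and the largest eigenvalue alike.\<close>

definition adj_form ::
    "'a pair_pre_digraph \<Rightarrow> real \<Rightarrow> real \<Rightarrow> ('a \<Rightarrow> real) \<Rightarrow> ('a \<Rightarrow> real) \<Rightarrow> real" where
  "adj_form G s t f g = (\<Sum>v\<in>pverts G. g v * (s * (\<Sum>u\<in>nbrs G v. f u) + t * f v))"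

text \<open>Removes the vertex enumeration: an eigenvector becomes a function on the vertices,
  whatever the ordering.\<close>

lemma eigenvalue_adjacency_mat_iff:
  assumes vs: "distinct vs" "set vs = pverts G" and wf: "\<And>v. nbrs G v \<subseteq> pverts G"
  shows "eigenvalue (adjacency_mat G vs) k \<longleftrightarrow>
    (\<exists>f. (\<exists>v\<in>pverts G. f v \<noteq> 0) \<and> (\<forall>v\<in>pverts G. (\<Sum>u\<in>nbrs G v. f u) = k * f v))"
    (is "_ \<longleftrightarrow> ?R")
proof -
  let ?n = "length vs"
  have bij: "bij_betw ((!) vs) {..<?n} (pverts G)"
    using bij_betw_nth[OF vs(1), of "{..<?n}" "pverts G"] vs(2) by simp
  have fin: "finite (pverts G)" using vs(2) by (metis List.finite_set)
  have row: "(adjacency_mat G vs *\<^sub>v w) $ i = (\<Sum>u\<in>nbrs G (vs ! i). f u)"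
    if "i < ?n" "dim_vec w = ?n" "\<And>j. j < ?n \<Longrightarrow> f (vs ! j) = w $ j" for i w f
  proof -
    have "(adjacency_mat G vs *\<^sub>v w) $ i
        = (\<Sum>j = 0..<?n. of_bool ((vs ! i, vs ! j) \<in> parcs G) * w $ j)"
      using that unfolding adjacency_mat_def by (simp add: scalar_prod_def)
    also have "\<dots> = (\<Sum>j<?n. if vs ! j \<in> nbrs G (vs ! i) then f (vs ! j) else 0)"
      using that(3) by (intro sum.cong) (auto simp: nbrs_def)
    also have "\<dots> = (\<Sum>u\<in>pverts G. if u \<in> nbrs G (vs ! i) then f u else 0)"
      by (rule sum.reindex_bij_betw[OF bij])
    also have "\<dots> = (\<Sum>u\<in>nbrs G (vs ! i). f u)"
      using wf fin by (subst sum.inter_restrict[symmetric]) (auto simp: Int_absorb1)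
    finally show ?thesis .
  qed
  have dim: "dim_row (adjacency_mat G vs) = ?n" by (simp add: adjacency_mat_def)
  show ?thesis
  proof
    assume "eigenvalue (adjacency_mat G vs) k"
    then obtain w where w: "dim_vec w = ?n" "w \<noteq> 0\<^sub>v ?n" "adjacency_mat G vs *\<^sub>v w = k \<cdot>\<^sub>v w"
      unfolding eigenvalue_def eigenvector_def dim by (metis carrier_vecD)
    define f where "f = (\<lambda>v. w $ inv_into {..<?n} ((!) vs) v)"
    have f: "f (vs ! j) = w $ j" if "j < ?n" for j
      using that bij unfolding f_def by (simp add: bij_betw_inv_into_left)
    obtain i where i: "i < ?n" "w $ i \<noteq> 0" using w(1,2) by (metis eq_vecI index_zero_vec)
    have "vs ! i \<in> pverts G" using i(1) vs(2) nth_mem by blast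
    then have "\<exists>v\<in>pverts G. f v \<noteq> 0" using i f[of i] by (intro bexI[of _ "vs ! i"]) simp_all
    moreover have eig: "(\<Sum>u\<in>nbrs G v. f u) = k * f v" if v: "v \<in> pverts G" for v
    proof -
      obtain i where i: "i < ?n" "v = vs ! i"
        using v unfolding vs(2)[symmetric] in_set_conv_nth by blast
      have "(\<Sum>u\<in>nbrs G v. f u) = (k \<cdot>\<^sub>v w) $ i"
        using row[OF i(1) w(1) f] unfolding w(3) i(2) by simp
      also have "\<dots> = k * f v" using i f[OF i(1)] w(1) by simp
      finally show ?thesis .
    qed
    ultimately show ?R by (intro exI[of _ f] conjI ballI)
  next
    assume ?R
    then obtain f where f: "\<exists>v\<in>pverts G. f v \<noteq> 0" "\<forall>v\<in>pverts G. (\<Sum>u\<in>nbrs G v. f u) = k * f v"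
      by blast
    define w where "w = Matrix.vec ?n (\<lambda>i. f (vs ! i))"
    have w: "dim_vec w = ?n" "\<And>j. j < ?n \<Longrightarrow> f (vs ! j) = w $ j" by (simp_all add: w_def)
    obtain v where v: "v \<in> pverts G" "f v \<noteq> 0" using f(1) by (rule bexE)
    then obtain i where i: "i < ?n" "v = vs ! i"
      unfolding vs(2)[symmetric] in_set_conv_nth by blast
    have "w $ i \<noteq> 0" using w(2)[OF i(1)] i(2) v(2) by simp
    then have "w \<noteq> 0\<^sub>v ?n" using i(1) by auto
    moreover have "adjacency_mat G vs *\<^sub>v w = k \<cdot>\<^sub>v w"
    proof (rule eq_vecI)
      show "dim_vec (adjacency_mat G vs *\<^sub>v w) = dim_vec (k \<cdot>\<^sub>v w)" using w dim by simp
      fix i assume "i < dim_vec (k \<cdot>\<^sub>v w)"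
      then have i: "i < ?n" using w by simp
      have "(adjacency_mat G vs *\<^sub>v w) $ i = k * f (vs ! i)"
        using row[OF i w] f(2) nth_mem[OF i] unfolding vs(2) by simp
      then show "(adjacency_mat G vs *\<^sub>v w) $ i = (k \<cdot>\<^sub>v w) $ i"
        using w(1) w(2)[OF i] i by simp
    qed
    ultimately show "eigenvalue (adjacency_mat G vs) k"
      unfolding eigenvalue_def eigenvector_def dim using w(1) by (auto intro!: carrier_vecI)
  qed
qed

section \<open>Quadratic form of the adjacency matrix and extreme eigenvalues\<close>

context pair_graph
begin

lemma nbrs_subset: "nbrs G v \<subseteq> pverts G"
  unfolding nbrs_def by (auto dest: in_arcsD2)

lemma nbrs_Collect: "nbrs G v = {u \<in> pverts G. (v, u) \<in> parcs G}"
  unfolding nbrs_def by (auto dest: in_arcsD2)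

lemma finite_nbrs[simp]: "finite (nbrs G v)"
  using nbrs_subset pair_finite_verts by (rule finite_subset)

lemma arcs_commute: "(u, v) \<in> parcs G \<longleftrightarrow> (v, u) \<in> parcs G"
  using pair_sym_arcs unfolding symmetric_def by (auto elim: symE)

lemma nbrs_commute: "u \<in> nbrs G v \<longleftrightarrow> v \<in> nbrs G u"
  unfolding nbrs_def by (simp add: arcs_commute)

lemma not_self_nbr: "v \<notin> nbrs G v"
  unfolding nbrs_def using pair_no_loops by fastforce

lemma adjacency_eigenvalues_iff:
  "k \<in> adjacency_eigenvalues G \<longleftrightarrow>
    (\<exists>f. (\<exists>v\<in>pverts G. f v \<noteq> 0) \<and> (\<forall>v\<in>pverts G. (\<Sum>u\<in>nbrs G v. f u) = k * f v))"
    (is "_ \<longleftrightarrow> ?R")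
proof -
  define Q where "Q \<longleftrightarrow> ?R"
  obtain vs where "distinct vs" "set vs = pverts G"
    using finite_distinct_list[OF pair_finite_verts] by blast
  moreover have "eigenvalue (adjacency_mat G vs) k \<longleftrightarrow> Q" if "distinct vs" "set vs = pverts G" for vs
    unfolding Q_def by (rule eigenvalue_adjacency_mat_iff[OF that nbrs_subset])
  ultimately have "k \<in> adjacency_eigenvalues G \<longleftrightarrow> Q"
    unfolding adjacency_eigenvalues_def by blast
  then show ?thesis unfolding Q_def .
qed

text \<open>\<open>Max\<close> and \<open>Min\<close> in \<open>lambda_max\<close> and
  \<open>lambda_min\<close> need a finite set. The eigenvalues are the roots of a nonzero
  characteristic polynomial.\<close>

lemma finite_adjacency_eigenvalues: "finite (adjacency_eigenvalues G)"
proof -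
  obtain vs where vs: "distinct vs" "set vs = pverts G"
    using finite_distinct_list[OF pair_finite_verts] by blast
  let ?A = "adjacency_mat G vs"
  have A: "?A \<in> carrier_mat (length vs) (length vs)" by (simp add: adjacency_mat_def)
  have "adjacency_eigenvalues G = {k. poly (char_poly ?A) k = 0}"
    by (simp add: set_eq_iff adjacency_eigenvalues_iff eigenvalue_root_char_poly[OF A, symmetric]
        eigenvalue_adjacency_mat_iff[OF vs nbrs_subset])
  moreover have "char_poly ?A \<noteq> 0" using degree_monic_char_poly[OF A] by auto
  ultimately show ?thesis using poly_roots_finite by metis
qed

lemma adj_form_commute: "adj_form G s t f g = adj_form G s t g f"
proof -
  have "(\<Sum>v\<in>pverts G. \<Sum>u\<in>nbrs G v. g v * f u) = (\<Sum>u\<in>pverts G. \<Sum>v\<in>nbrs G u. g v * f u)"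
    unfolding nbrs_Collect
    using sum.swap_restrict[OF pair_finite_verts pair_finite_verts, of "\<lambda>v u. g v * f u" "\<lambda>v u. (v, u) \<in> parcs G"]
    by (simp add: arcs_commute)
  then show ?thesis
    unfolding adj_form_def
    by (simp add: algebra_simps sum.distrib sum_distrib_left)
      (simp add: sum_distrib_left[symmetric] mult.commute)
qed

lemma adj_form_add_scaled:
  "adj_form G s t (\<lambda>v. f v + c * g v) (\<lambda>v. f v + c * g v) =
    adj_form G s t f f + 2 * c * adj_form G s t f g + c\<^sup>2 * adj_form G s t g g"
proof -
  have "adj_form G s t (\<lambda>v. f v + c * g v) (\<lambda>v. f v + c * g v) =
    adj_form G s t f f + c * adj_form G s t f g + c * adj_form G s t g f + c\<^sup>2 * adj_form G s t g g"
    unfolding adj_form_def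
    by (simp add: sum.distrib sum_distrib_left algebra_simps power2_eq_square)
  then show ?thesis using adj_form_commute[of s t f g] by simp
qed

text \<open>If the mixed term were nonzero, a small move from f along g, against the sign of that
  term, would make the form negative.\<close>

lemma psd_null_form:
  assumes psd: "\<And>f. 0 \<le> adj_form G s t f f" and null: "adj_form G s t f f = 0"
  shows "adj_form G s t f g = 0"
proof (rule ccontr)
  let ?b = "adj_form G s t f g" and ?c = "adj_form G s t g g"
  assume b: "?b \<noteq> 0"
  have c: "0 \<le> ?c" by (rule psd)
  \<comment> \<open>The minimizer in r is -b/c; the added 1 keeps the denominator positive when c =
    0 and still yields a negative value.\<close>
  let ?r = "- ?b / (?c + 1)"
  have "0 \<le> 2 * ?r * ?b + ?r\<^sup>2 * ?c"
    using psd[of "\<lambda>v. f v + ?r * g v"] null unfolding adj_form_add_scaled by simp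
  also have "\<dots> = - (?b\<^sup>2 * (?c + 2)) / (?c + 1)\<^sup>2"
    using c by (simp add: divide_simps power2_eq_square) (simp add: algebra_simps)
  also have "\<dots> < 0" using b c by (auto intro!: divide_neg_pos mult_pos_pos)
  finally show False by simp
qed

lemma adj_form_indicator:
  assumes "v \<in> pverts G"
  shows "adj_form G s t f (\<lambda>u. if u = v then 1 else 0) = s * (\<Sum>u\<in>nbrs G v. f u) + t * f v"
proof -
  have "adj_form G s t f (\<lambda>u. if u = v then 1 else 0) =
    (\<Sum>w\<in>pverts G. if w = v then s * (\<Sum>u\<in>nbrs G w. f u) + t * f w else 0)"
    unfolding adj_form_def by (intro sum.cong) auto
  then show ?thesis using assms by (simp add: pair_finite_verts)
qed

text \<open>Testing against the indicator of v turns a null vector of the form into a solution of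
  the eigenvalue equation at v.\<close>

lemma psd_null_eigenvector:
  assumes "\<And>f. 0 \<le> adj_form G s t f f" "adj_form G s t f f = 0" "v \<in> pverts G"
  shows "s * (\<Sum>u\<in>nbrs G v. f u) + t * f v = 0"
  using psd_null_form[OF assms(1,2)] adj_form_indicator[OF assms(3)] by metis

lemma adj_form_shift: "adj_form G s t f f = adj_form G s 0 f f + t * (\<Sum>v\<in>pverts G. (f v)\<^sup>2)"
  unfolding adj_form_def by (simp add: algebra_simps sum.distrib sum_distrib_left power2_eq_square)

text \<open>Minimize the form over the unit sphere; t is minus the minimum. With s = 1 and s = -1
  this yields both extreme eigenvalues without the spectral theorem.\<close>

lemma exists_psd_null_vector:
  assumes ne: "pverts G \<noteq> {}"
  obtains f t where "\<exists>v\<in>pverts G. f v \<noteq> 0" "adj_form G s t f f = 0" "\<And>g. 0 \<le> adj_form G s t g g"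
proof -
  let ?V = "pverts G" and ?q = "\<lambda>f. adj_form G s 0 f f"
  \<comment> \<open>The vertex type may be infinite, so coordinates off the graph are pinned to {0}:
    the box is then a compact product, and the sphere cuts a compact set out of it.\<close>
  let ?K = "{f \<in> (\<Pi>\<^sub>E i\<in>UNIV. if i \<in> ?V then {-1..1} else {0}). (\<Sum>v\<in>?V. (f v)\<^sup>2) = (1::real)}"
  have "compact (\<Pi>\<^sub>E i\<in>UNIV. if i \<in> ?V then {-1..1} else {0::real})"
    unfolding compactin_euclidean_iff[symmetric] euclidean_product_topology[symmetric]
    by (subst compactin_PiE) (auto simp: compactin_euclidean_iff)
  moreover have cont: "continuous_on UNIV (\<lambda>f :: 'a \<Rightarrow> real. \<Sum>v\<in>?V. (f v)\<^sup>2)"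
    by (intro continuous_intros) auto
  then have "closed {f. (\<Sum>v\<in>?V. (f v)\<^sup>2) = (1::real)}"
    using closed_Collect_eq[OF cont continuous_on_const] by simp
  ultimately have "compact ((\<Pi>\<^sub>E i\<in>UNIV. if i \<in> ?V then {-1..1} else {0})
      \<inter> {f. (\<Sum>v\<in>?V. (f v)\<^sup>2) = (1::real)})"
    by (rule compact_Int_closed)
  then have "compact ?K"
    by (rule back_subst[of compact]) blast
  moreover have contq: "continuous_on UNIV ?q"
    unfolding adj_form_def by (intro continuous_intros) auto
  moreover have "?K \<noteq> {}"
  proof -
    obtain v where v: "v \<in> ?V" using ne by blast
    have "(\<Sum>u\<in>?V. (if u = v then 1 else 0 :: real)\<^sup>2) = (\<Sum>u\<in>?V. if u = v then 1 else 0)"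
      by (rule sum.cong) auto
    then have "(\<lambda>u. if u = v then 1 else 0) \<in> ?K"
      using v by (auto simp: pair_finite_verts)
    then show ?thesis by blast
  qed
  ultimately obtain f where f: "f \<in> ?K" "\<And>g. g \<in> ?K \<Longrightarrow> ?q f \<le> ?q g"
    using continuous_attains_inf[OF _ _ continuous_on_subset[OF contq], of ?K] by auto
  have f1: "(\<Sum>v\<in>?V. (f v)\<^sup>2) = 1" using f(1) by simp
  have "0 \<le> adj_form G s (- ?q f) g g" for g
  proof (cases "\<forall>v\<in>?V. g v = 0")
    case True
    then show ?thesis unfolding adj_form_def by simp
  next
    case False
    define N where "N = (\<Sum>v\<in>?V. (g v)\<^sup>2)"
    have N: "N > 0"
      unfolding N_def using False pair_finite_verts by (auto intro!: sum_pos2)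
    define h where "h = (\<lambda>v. if v \<in> ?V then g v / sqrt N else 0)"
    have hsq: "(h v)\<^sup>2 = (g v)\<^sup>2 / N" if "v \<in> ?V" for v
      using that N by (simp add: h_def power_divide)
    have h1: "(\<Sum>v\<in>?V. (h v)\<^sup>2) = 1"
      using N hsq by (simp add: sum_divide_distrib[symmetric] N_def[symmetric])
    have "(h v)\<^sup>2 \<le> 1" if "v \<in> ?V" for v
      using member_le_sum[of v ?V "\<lambda>v. (h v)\<^sup>2"] that h1 pair_finite_verts by simp
    then have "\<bar>h v\<bar> \<le> 1" if "v \<in> ?V" for v
      using that abs_square_le_1 by blast
    then have "-1 \<le> h v \<and> h v \<le> 1" if "v \<in> ?V" for v
      using that by (simp add: abs_le_iff minus_le_iff)
    moreover have "h v = 0" if "v \<notin> ?V" for v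
      using that by (simp add: h_def)
    ultimately have "h \<in> ?K"
      using h1 by auto
    then have le: "?q f \<le> ?q h" by (rule f(2))
    have "?q h = ?q g / N"
    proof -
      have "(\<Sum>u\<in>nbrs G v. h u) = (\<Sum>u\<in>nbrs G v. g u) / sqrt N" for v
        unfolding sum_divide_distrib using nbrs_subset by (intro sum.cong) (auto simp: h_def)
      then have "?q h = (\<Sum>v\<in>?V. (g v / sqrt N) * (s * ((\<Sum>u\<in>nbrs G v. g u) / sqrt N)))"
        unfolding adj_form_def by (intro sum.cong) (simp_all add: h_def)
      also have "\<dots> = (\<Sum>v\<in>?V. g v * (s * (\<Sum>u\<in>nbrs G v. g u)) / N)"
      proof (rule sum.cong)
        show "(g v / sqrt N) * (s * ((\<Sum>u\<in>nbrs G v. g u) / sqrt N))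
          = g v * (s * (\<Sum>u\<in>nbrs G v. g u)) / N" for v
          using N real_sqrt_mult_self[of N] by (simp add: field_simps)
      qed simp
      also have "\<dots> = ?q g / N"
        unfolding adj_form_def by (simp add: sum_divide_distrib)
      finally show ?thesis .
    qed
    then have "?q f * N \<le> ?q g" using mult_right_mono[OF le, of N] N by simp
    then show ?thesis unfolding adj_form_shift[of s "- ?q f"] N_def by simp
  qed
  moreover have "adj_form G s (- ?q f) f f = 0"
    unfolding adj_form_shift[of s "- ?q f"] using f1 by simp
  moreover have "\<exists>v\<in>?V. f v \<noteq> 0" using f1 by (metis (mono_tags, lifting) power_zero_numeral sum.neutral zero_neq_one)
  ultimately show thesis using that by blast
qed

lemma eigenvector_form:
  assumes "\<And>v. v \<in> pverts G \<Longrightarrow> (\<Sum>u\<in>nbrs G v. f u) = k * f v"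
  shows "adj_form G s t f f = (s * k + t) * (\<Sum>v\<in>pverts G. (f v)\<^sup>2)"
proof -
  have "adj_form G s t f f = (\<Sum>v\<in>pverts G. (s * k + t) * (f v)\<^sup>2)"
    unfolding adj_form_def using assms
    by (intro sum.cong) (simp_all add: algebra_simps power2_eq_square)
  then show ?thesis by (simp add: sum_distrib_left)
qed

lemma sum_squares_pos:
  assumes "\<exists>v\<in>pverts G. (f v :: real) \<noteq> 0"
  shows "0 < (\<Sum>v\<in>pverts G. (f v)\<^sup>2)"
  using assms pair_finite_verts by (auto intro!: sum_pos2)

text \<open>The null vector shows that -t is an eigenvalue, and evaluating the form at any
  eigenvector shows that no eigenvalue is smaller; so t = -lambda_min.\<close>

lemma adj_form_lambda_min_nonneg:
  assumes "pverts G \<noteq> {}"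
  shows "0 \<le> adj_form G 1 (- lambda_min G) g g"
proof -
  obtain f t where f: "\<exists>v\<in>pverts G. f v \<noteq> 0" "adj_form G 1 t f f = 0" "\<And>g. 0 \<le> adj_form G 1 t g g"
    using exists_psd_null_vector[OF assms] by metis
  have "(\<Sum>u\<in>nbrs G v. f u) = - t * f v" if "v \<in> pverts G" for v
    using psd_null_eigenvector[OF f(3,2) that] by simp
  then have mem: "- t \<in> adjacency_eigenvalues G"
    unfolding adjacency_eigenvalues_iff using f(1) by blast
  have "- t \<le> k" if k: "k \<in> adjacency_eigenvalues G" for k
  proof -
    obtain h where h: "\<exists>v\<in>pverts G. h v \<noteq> 0" "\<forall>v\<in>pverts G. (\<Sum>u\<in>nbrs G v. h u) = k * h v"
      using k unfolding adjacency_eigenvalues_iff by blast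
    have "0 \<le> (1 * k + t) * (\<Sum>v\<in>pverts G. (h v)\<^sup>2)"
      using f(3)[of h] eigenvector_form[of h k 1 t] h(2) by simp
    then show ?thesis using sum_squares_pos[OF h(1)] by (simp add: zero_le_mult_iff)
  qed
  then have "lambda_min G = - t"
    unfolding lambda_min_def by (intro Min_eqI finite_adjacency_eigenvalues mem)
  then show ?thesis using f(3) by simp
qed

text \<open>Connectedness as an induction along arcs; in this form it becomes the assumption
  \<open>closed\<close> of \<open>hoffman_weighting\<close>.\<close>

lemma closed_under_nbrs:
  assumes con: "Digraph_Component.connected (with_proj G)"
    and S: "u \<in> S" "u \<in> pverts G" "\<And>v. v \<in> S \<Longrightarrow> nbrs G v \<subseteq> S"
  shows "pverts G \<subseteq> S"
proof
  fix v assume v: "v \<in> pverts G"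
  have "(u, v) \<in> rtrancl_on (pverts G) (symcl (parcs G))"
    using con S(2) v unfolding connected_conv by auto
  then show "v \<in> S"
  proof (induction rule: rtrancl_on_induct)
    case base
    then show ?case using S(1) by simp
  next
    case (step y z)
    then have "z \<in> nbrs G y" by (auto simp: symcl_def nbrs_def arcs_commute)
    then show ?case using S(3) step by blast
  qed
qed

text \<open>Perron's argument for the form of t I - A: passing to absolute values does not increase
  it, so |f| is null as well and hence an eigenvector for t, the largest eigenvalue. Its zeros
  spread to neighbors, so by connectedness a single zero would make it vanish.\<close>

lemma lambda_max_eigenvector_pos:
  assumes con: "Digraph_Component.connected (with_proj G)"
  obtains x where "\<And>v. v \<in> pverts G \<Longrightarrow> 0 < x v"
    "\<And>v. v \<in> pverts G \<Longrightarrow> (\<Sum>u\<in>nbrs G v. x u) = lambda_max G * x v"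
proof -
  have ne: "pverts G \<noteq> {}" using con unfolding connected_conv by auto
  obtain f t where f: "\<exists>v\<in>pverts G. f v \<noteq> 0" "adj_form G (-1) t f f = 0" "\<And>g. 0 \<le> adj_form G (-1) t g g"
    using exists_psd_null_vector[OF ne] by metis
  define x where "x = (\<lambda>v. \<bar>f v\<bar>)"
  have "adj_form G (-1) t x x \<le> adj_form G (-1) t f f"
    unfolding adj_form_def
  proof (rule sum_mono)
    fix v
    have "f v * (\<Sum>u\<in>nbrs G v. f u) \<le> \<bar>f v\<bar> * \<bar>\<Sum>u\<in>nbrs G v. f u\<bar>"
      by (metis abs_ge_self abs_mult)
    also have "\<dots> \<le> x v * (\<Sum>u\<in>nbrs G v. x u)"
      unfolding x_def by (intro mult_left_mono sum_abs) auto
    finally show "x v * (- 1 * (\<Sum>u\<in>nbrs G v. x u) + t * x v) \<le> f v * (- 1 * (\<Sum>u\<in>nbrs G v. f u) + t * f v)"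
      by (simp add: algebra_simps x_def)
  qed
  then have "adj_form G (-1) t x x = 0" using f(2) f(3)[of x] by simp
  then have eig: "(\<Sum>u\<in>nbrs G v. x u) = t * x v" if "v \<in> pverts G" for v
    using psd_null_eigenvector[OF f(3) _ that, of x] by simp
  have ex: "\<exists>v\<in>pverts G. x v \<noteq> 0" using f(1) by (simp add: x_def)
  have mem: "t \<in> adjacency_eigenvalues G"
    unfolding adjacency_eigenvalues_iff using eig ex by blast
  have "k \<le> t" if k: "k \<in> adjacency_eigenvalues G" for k
  proof -
    obtain h where h: "\<exists>v\<in>pverts G. h v \<noteq> 0" "\<forall>v\<in>pverts G. (\<Sum>u\<in>nbrs G v. h u) = k * h v"
      using k unfolding adjacency_eigenvalues_iff by blast
    have "0 \<le> (- 1 * k + t) * (\<Sum>v\<in>pverts G. (h v)\<^sup>2)"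
      using f(3)[of h] eigenvector_form[of h k "-1" t] h(2) by simp
    then show ?thesis using sum_squares_pos[OF h(1)] by (simp add: zero_le_mult_iff)
  qed
  then have max: "lambda_max G = t"
    unfolding lambda_max_def by (intro Max_eqI finite_adjacency_eigenvalues mem)
  have "0 < x v" if v: "v \<in> pverts G" for v
  proof (rule ccontr)
    assume "\<not> 0 < x v"
    then have v0: "x v = 0" by (simp add: x_def)
    have "pverts G \<subseteq> {v \<in> pverts G. x v = 0}"
    proof (rule closed_under_nbrs[OF con])
      fix w assume w: "w \<in> {v \<in> pverts G. x v = 0}"
      then have "(\<Sum>u\<in>nbrs G w. x u) = 0" using eig[of w] by simp
      then have "\<forall>u\<in>nbrs G w. x u = 0"
        by (subst (asm) sum_nonneg_eq_0_iff) (auto simp: x_def)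
      then show "nbrs G w \<subseteq> {v \<in> pverts G. x v = 0}" using nbrs_subset by blast
    qed (use v v0 in auto)
    then show False using ex by auto
  qed
  with eig max show thesis using that by blast
qed

end

section \<open>Equality in Hoffman's bound\<close>

text \<open>The parameter \<open>m\<close> is \<open>- \<lambda>\<^sub>m\<^sub>i\<^sub>n\<close>; the assumption \<open>closed\<close> is connectedness.\<close>

locale hoffman_weighting = pair_graph X for X :: "'c pair_pre_digraph" +
  fixes c :: "'c \<Rightarrow> nat" and k :: nat and x :: "'c \<Rightarrow> real" and m :: real
  assumes three_colors: "3 \<le> k"
    and mu: "1 < m" "m < 2"
    and ne: "pverts X \<noteq> {}"
    and closed: "\<And>S u. u \<in> S \<Longrightarrow> u \<in> pverts X \<Longrightarrow> (\<And>v. v \<in> S \<Longrightarrow> nbrs X v \<subseteq> S) \<Longrightarrow> pverts X \<subseteq> S"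
    and color_less: "\<And>v. v \<in> pverts X \<Longrightarrow> c v < k"
    and color_nbr: "\<And>u v. u \<in> nbrs X v \<Longrightarrow> c u \<noteq> c v"
    and weight_pos: "\<And>v. v \<in> pverts X \<Longrightarrow> 0 < x v"
    and weight_sum: "\<And>v i. v \<in> pverts X \<Longrightarrow> i < k \<Longrightarrow> i \<noteq> c v \<Longrightarrow>
      (\<Sum>u | u \<in> nbrs X v \<and> c u = i. x u) = m * x v"
    and psd: "\<And>f. 0 \<le> adj_form X 1 m f f"

text \<open>A graph X is given only up to isomorphism as a generalized line graph. Pulling the
  weighting back spares any proof that chromatic number and extreme eigenvalues are isomorphism
  invariants.\<close>

lemma hoffman_weighting_iso:
  assumes X: "hoffman_weighting X c k x m" and Y: "pair_graph Y"
    and bij: "bij_betw h (pverts Y) (pverts X)"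
    and adj: "\<And>u v. u \<in> pverts Y \<Longrightarrow> v \<in> pverts Y \<Longrightarrow> (h u, h v) \<in> parcs X \<longleftrightarrow> (u, v) \<in> parcs Y"
  shows "hoffman_weighting Y (c \<circ> h) k (x \<circ> h) m"
proof -
  interpret X: hoffman_weighting X c k x m by (rule X)
  interpret Y: pair_graph Y by (rule Y)
  have inj: "inj_on h (pverts Y)" and V: "pverts X = h ` pverts Y"
    using bij by (auto simp: bij_betw_def)
  have nb: "nbrs X (h v) = h ` nbrs Y v" if "v \<in> pverts Y" for v
    using that adj unfolding X.nbrs_Collect Y.nbrs_Collect V by auto
  have sumnb: "(\<Sum>u | u \<in> nbrs Y v \<and> P u. f (h u)) = (\<Sum>u | u \<in> nbrs X (h v) \<and> Q u. f u)"
    if "v \<in> pverts Y" "\<And>u. P u \<longleftrightarrow> Q (h u)" for v P Q and f :: "_ \<Rightarrow> real"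
  proof -
    have "inj_on h {u. u \<in> nbrs Y v \<and> P u}"
      by (rule inj_on_subset[OF inj]) (use Y.nbrs_subset in blast)
    moreover have "{u. u \<in> nbrs X (h v) \<and> Q u} = h ` {u. u \<in> nbrs Y v \<and> P u}"
      using nb[OF that(1)] that(2) by auto
    ultimately show ?thesis by (simp add: sum.reindex)
  qed
  show ?thesis
  proof unfold_locales
    show "3 \<le> k" "1 < m" "m < 2" using X.three_colors X.mu by auto
    show "pverts Y \<noteq> {}" using X.ne V by auto
    show "pverts Y \<subseteq> S"
      if S: "u \<in> S" "u \<in> pverts Y" "\<And>v. v \<in> S \<Longrightarrow> nbrs Y v \<subseteq> S" for S u
    proof -
      have "pverts X \<subseteq> h ` (S \<inter> pverts Y)"
      proof (rule X.closed)
        show "nbrs X v \<subseteq> h ` (S \<inter> pverts Y)" if "v \<in> h ` (S \<inter> pverts Y)" for v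
          using that nb S(3) Y.nbrs_subset by blast
      qed (use S V in auto)
      then show ?thesis using V inj by (auto dest: inj_onD)
    qed
    show "(c \<circ> h) v < k" if "v \<in> pverts Y" for v using that X.color_less V by simp
    show "0 < (x \<circ> h) v" if "v \<in> pverts Y" for v using that X.weight_pos V by simp
    show "(c \<circ> h) u \<noteq> (c \<circ> h) v" if "u \<in> nbrs Y v" for u v
    proof -
      have "v \<in> pverts Y" using that Y.nbrs_subset Y.nbrs_commute by blast
      then show ?thesis using that X.color_nbr nb by fastforce
    qed
    show "(\<Sum>u | u \<in> nbrs Y v \<and> (c \<circ> h) u = i. (x \<circ> h) u) = m * (x \<circ> h) v"
      if "v \<in> pverts Y" "i < k" "i \<noteq> (c \<circ> h) v" for v i
      using sumnb[OF that(1), of "\<lambda>u. c (h u) = i" "\<lambda>u. c u = i" x] X.weight_sum[of "h v" i] that V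
      by simp
    show "0 \<le> adj_form Y 1 m f f" for f
    proof -
      define g where "g = (\<lambda>u. f (the_inv_into (pverts Y) h u))"
      have g: "g (h v) = f v" if "v \<in> pverts Y" for v
        using that inj by (simp add: g_def the_inv_into_f_f)
      have "adj_form X 1 m g g
          = (\<Sum>v\<in>pverts Y. g (h v) * (1 * (\<Sum>u\<in>nbrs X (h v). g u) + m * g (h v)))"
        unfolding adj_form_def V using sum.reindex[OF inj] by simp
      also have "\<dots> = adj_form Y 1 m f f"
        unfolding adj_form_def
      proof (rule sum.cong)
        fix v assume v: "v \<in> pverts Y"
        have "(\<Sum>u\<in>nbrs X (h v). g u) = (\<Sum>u\<in>nbrs Y v. g (h u))"
          using sumnb[OF v, of "\<lambda>_. True" "\<lambda>_. True" g] by simp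
        also have "\<dots> = (\<Sum>u\<in>nbrs Y v. f u)"
          using Y.nbrs_subset g by (intro sum.cong) auto
        finally show "g (h v) * (1 * (\<Sum>u\<in>nbrs X (h v). g u) + m * g (h v))
          = f v * (1 * (\<Sum>u\<in>nbrs Y v. f u) + m * f v)"
          using g[OF v] by simp
      qed simp
      finally show ?thesis using X.psd[of g] by simp
    qed
  qed
qed

section \<open>From Hoffman equality to a weighting\<close>

context pair_graph
begin

text \<open>For a test vector, only the subgraph induced on its support has to be inspected.\<close>

lemma adj_form_supported:
  assumes S: "S \<subseteq> pverts G" "\<And>v. v \<notin> S \<Longrightarrow> f v = 0"
  shows "adj_form G s t f f = s * (\<Sum>v\<in>S. f v * (\<Sum>u\<in>nbrs G v \<inter> S. f u)) + t * (\<Sum>v\<in>S. (f v)\<^sup>2)"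
proof -
  have "(\<Sum>u\<in>nbrs G v. f u) = (\<Sum>u\<in>nbrs G v \<inter> S. f u)" for v
    using S(2) by (intro sum.mono_neutral_right) auto
  then have "adj_form G s t f f = (\<Sum>v\<in>S. f v * (s * (\<Sum>u\<in>nbrs G v \<inter> S. f u) + t * f v))"
    unfolding adj_form_def using S pair_finite_verts by (intro sum.mono_neutral_cong_right) auto
  then show ?thesis
    by (simp add: algebra_simps sum.distrib sum_distrib_left power2_eq_square)
qed

text \<open>The vector (1, -1) on an edge gives the form the value -2 - 2 lambda_min, so lambda_min
  is even at most -1.\<close>

lemma lambda_min_neg:
  assumes "parcs G \<noteq> {}"
  shows "lambda_min G < 0"
proof -
  obtain u v where uv: "(u, v) \<in> parcs G" using assms by auto
  have V: "u \<in> pverts G" "v \<in> pverts G" "u \<noteq> v"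
    using uv in_arcsD1 in_arcsD2 pair_no_loops by fastforce+
  define f :: "'a \<Rightarrow> real" where "f = (\<lambda>w. if w = u then 1 else if w = v then -1 else 0)"
  have nb: "nbrs G u \<inter> {u, v} = {v}" "nbrs G v \<inter> {u, v} = {u}"
    using uv not_self_nbr arcs_commute by (auto simp: nbrs_def)
  have "adj_form G 1 (- lambda_min G) f f = -2 - 2 * lambda_min G"
    using V nb by (subst adj_form_supported[where S="{u, v}"]) (auto simp: f_def)
  moreover have "pverts G \<noteq> {}" using V by blast
  ultimately show ?thesis using adj_form_lambda_min_nonneg[of f] by linarith
qed

text \<open>The restrictions \<open>r j\<close> of x to the color classes sum to x, and
  \<open>eq\<close> is what makes the nonnegative values of the form at the vectors
  \<open>y j\<close> sum to zero.\<close>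

lemma hoffman_equality:
  assumes col: "proper_coloring G k c"
    and t: "\<And>f. 0 \<le> adj_form G 1 m f f"
    and x: "\<And>v. v \<in> pverts G \<Longrightarrow> (\<Sum>u\<in>nbrs G v. x u) = \<theta> * x v"
    and eq: "real k * m = \<theta> + m" and k: "0 < k"
    and v: "v \<in> pverts G" and i: "i < k" "i \<noteq> c v"
  shows "(\<Sum>u | u \<in> nbrs G v \<and> c u = i. x u) = m * x v"
proof -
  define r where "r = (\<lambda>j v. if c v = j then x v else 0)"
  define y where "y = (\<lambda>j v. x v + (- real k) * r j v)"
  have ck: "c v < k" if "v \<in> pverts G" for v using col that unfolding proper_coloring_def by blast
  have cn: "c u \<noteq> c v" if "u \<in> nbrs G v" for u v
    using col that unfolding proper_coloring_def nbrs_def by fastforce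
  have sumr: "(\<Sum>j<k. r j v) = x v" if "v \<in> pverts G" for v
    using ck[OF that] unfolding r_def by simp
  have rnb: "r (c v) u = 0" if "u \<in> nbrs G v" for u v
    using cn[OF that] by (simp add: r_def)
  let ?N = "\<Sum>v\<in>pverts G. (x v)\<^sup>2"
  have xr: "adj_form G 1 m x (r j) = (\<theta> + m) * (\<Sum>v\<in>pverts G. r j v * x v)" for j
    unfolding adj_form_def sum_distrib_left
    by (rule sum.cong) (simp_all add: x algebra_simps)
  \<comment> \<open>A color class is independent, so only the diagonal part m survives.\<close>
  have rr: "adj_form G 1 m (r j) (r j) = m * (\<Sum>v\<in>pverts G. r j v * x v)" for j
    unfolding adj_form_def sum_distrib_left[of m]
  proof (rule sum.cong)
    fix v assume "v \<in> pverts G"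
    show "r j v * (1 * (\<Sum>u\<in>nbrs G v. r j u) + m * r j v) = m * (r j v * x v)" 
    proof (cases "c v = j")
      case True
      then have "(\<Sum>u\<in>nbrs G v. r j u) = 0" using rnb by (intro sum.neutral) auto
      then show ?thesis using True by (simp add: r_def)
    qed (simp add: r_def)
  qed simp
  have xx: "adj_form G 1 m x x = (\<theta> + m) * ?N" using eigenvector_form[of x \<theta>] x by simp
  have yy: "adj_form G 1 m (y j) (y j)
      = (\<theta> + m) * ?N - real k * (\<theta> + m) * (\<Sum>v\<in>pverts G. r j v * x v)" for j
  proof -
    have "adj_form G 1 m (y j) (y j) = adj_form G 1 m x x + 2 * (- real k) * adj_form G 1 m x (r j)
       + (- real k)\<^sup>2 * adj_form G 1 m (r j) (r j)"
      unfolding y_def by (rule adj_form_add_scaled)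
    also have "\<dots> = (\<theta> + m) * ?N + (- 2 * real k * (\<theta> + m) + real k * (real k * m)) * (\<Sum>v\<in>pverts G. r j v * x v)"
      unfolding xx xr rr by (simp add: algebra_simps power2_eq_square)
    finally show ?thesis unfolding eq by (simp add: algebra_simps)
  qed
  have "(\<Sum>j<k. \<Sum>v\<in>pverts G. r j v * x v) = ?N"
    by (subst sum.swap) (simp add: sum_distrib_right[symmetric] sumr power2_eq_square)
  then have "(\<Sum>j<k. adj_form G 1 m (y j) (y j)) = 0"
    unfolding yy by (simp add: sum_subtractf sum_distrib_left[symmetric])
  then have null: "adj_form G 1 m (y i) (y i) = 0"
    using i t by (subst (asm) sum_nonneg_eq_0_iff) auto
  \<comment> \<open>The kernel equation at v; as v does not have color i, the subtracted part is
    felt only through its neighbors.\<close>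
  have "(\<Sum>u\<in>nbrs G v. y i u) + m * y i v = 0"
    using psd_null_eigenvector[OF t null v] by simp
  moreover have "r i v = 0" using i by (simp add: r_def)
  then have "y i v = x v" by (simp add: y_def)
  moreover have "(\<Sum>u\<in>nbrs G v. y i u) = \<theta> * x v - real k * (\<Sum>u\<in>nbrs G v. r i u)"
    unfolding y_def by (simp add: sum_subtractf sum.distrib sum_negf sum_distrib_left[symmetric] x[OF v])
  ultimately have "real k * (\<Sum>u\<in>nbrs G v. r i u) = (\<theta> + m) * x v"
    by (simp add: algebra_simps)
  then have "real k * (\<Sum>u\<in>nbrs G v. r i u) = real k * (m * x v)"
    unfolding eq[symmetric] by simp
  then have "(\<Sum>u\<in>nbrs G v. r i u) = m * x v" using k by simp
  then show ?thesis unfolding r_def by (simp add: sum.inter_filter[symmetric])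
qed

lemma chromatic_number_coloring: obtains c where "proper_coloring G (chromatic_number G) c"
proof -
  obtain f where f: "inj_on f (pverts G)" "f ` pverts G = {..<card (pverts G)}"
    using ex_bij_betw_finite_nat[OF pair_finite_verts] unfolding bij_betw_def
    by (metis atLeast0LessThan)
  have "proper_coloring G (card (pverts G)) f"
    unfolding proper_coloring_def
  proof (intro conjI ballI)
    fix v assume "v \<in> pverts G"
    then show "f v < card (pverts G)" using f(2) by blast
  next
    fix p assume p: "p \<in> parcs G"
    then have "fst p \<in> pverts G" "snd p \<in> pverts G" "fst p \<noteq> snd p"
      using arc_fst_in_verts arc_snd_in_verts pair_no_loops by auto
    then show "case p of (u, v) \<Rightarrow> f u \<noteq> f v"
      using f(1) by (auto simp: case_prod_beta dest: inj_onD)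
  qed
  then have "\<exists>c. proper_coloring G (chromatic_number G) c"
    unfolding chromatic_number_def by (intro LeastI_ex[of "\<lambda>k. \<exists>c. proper_coloring G k c"] exI)
  then show thesis using that by blast
qed

lemma bipartite_if_two_coloring:
  assumes "proper_coloring G k c" "k \<le> 2"
  shows "bipartite G"
  unfolding bipartite_def
proof (intro exI conjI)
  let ?A = "{v \<in> pverts G. c v = 0}" and ?B = "{v \<in> pverts G. c v \<noteq> 0}"
  show "pverts G = ?A \<union> ?B" "?A \<inter> ?B = {}" by auto
  show "parcs G \<subseteq> ?A \<times> ?B \<union> ?B \<times> ?A"
  proof (rule subrelI)
    fix u v assume uv: "(u, v) \<in> parcs G"
    have V: "u \<in> pverts G" "v \<in> pverts G" using uv in_arcsD1 in_arcsD2 by auto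
    then have "c u < 2" "c v < 2" "c u \<noteq> c v"
      using assms uv(1) unfolding proper_coloring_def by fastforce+
    then show "(u, v) \<in> ?A \<times> ?B \<union> ?B \<times> ?A" using V by auto
  qed
qed

text \<open>The vector (1, -1, 1) on an induced path a, w, b has value 3 - 4 = -1. So distinct
  neighbors of a common vertex are adjacent, and u together with its neighbors is closed under
  adjacency.\<close>

lemma complete_if_psd_shift_1:
  assumes con: "Digraph_Component.connected (with_proj G)"
    and psd: "\<And>f. 0 \<le> adj_form G 1 1 f f"
    and uv: "u \<in> pverts G" "v \<in> pverts G" "u \<noteq> v"
  shows "(u, v) \<in> parcs G"
proof -
  have no_path: "(a, b) \<in> parcs G" if ab: "(a, w) \<in> parcs G" "(w, b) \<in> parcs G" "a \<noteq> b" for a w b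
  proof (rule ccontr)
    assume nab: "(a, b) \<notin> parcs G"
    define f :: "'a \<Rightarrow> real" where "f = (\<lambda>z. if z = w then -1 else if z = a \<or> z = b then 1 else 0)"
    have d: "a \<noteq> w" "b \<noteq> w" using ab pair_no_loops by fastforce+
    have V: "{a, w, b} \<subseteq> pverts G" using ab in_arcsD1 in_arcsD2 by auto
    have nb: "nbrs G a \<inter> {a, w, b} = {w}" "nbrs G b \<inter> {a, w, b} = {w}" "nbrs G w \<inter> {a, w, b} = {a, b}"
      using ab nab not_self_nbr arcs_commute[of a b] arcs_commute[of a w] arcs_commute[of w b]
      by (auto simp: nbrs_def)
    have "adj_form G 1 1 f f = -1"
      using d ab(3) nb V
      by (subst adj_form_supported[where S="{a, w, b}"]) (auto simp: f_def)
    then show False using psd[of f] by simp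
  qed
  have "pverts G \<subseteq> insert u (nbrs G u)"
  proof (rule closed_under_nbrs[OF con _ uv(1)])
    fix w assume "w \<in> insert u (nbrs G u)"
    then show "nbrs G w \<subseteq> insert u (nbrs G u)"
      using no_path by (auto simp: nbrs_def)
  qed simp
  then show ?thesis using uv by (auto simp: nbrs_def)
qed

text \<open>With parts of size 1, complete graphs belong to the trivial cases; this is how m \<le> 1
  is ruled out.\<close>

lemma complete_iso_equal_multipartite:
  assumes "\<And>u v. u \<in> pverts G \<Longrightarrow> v \<in> pverts G \<Longrightarrow> u \<noteq> v \<Longrightarrow> (u, v) \<in> parcs G"
  shows "digraph_iso (with_proj (equal_multipartite (card (pverts G)) 1)) (with_proj G)"
proof -
  obtain f where f: "bij_betw f {..<card (pverts G)} (pverts G)"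
    using ex_bij_betw_nat_finite[OF pair_finite_verts] by (metis atLeast0LessThan)
  show ?thesis
  proof (rule digraph_iso_pairI)
    show "pair_wf_digraph (equal_multipartite (card (pverts G)) 1)"
      by unfold_locales (auto simp: equal_multipartite_def)
    show "pair_wf_digraph G" by unfold_locales
    show "bij_betw (f \<circ> fst) (pverts (equal_multipartite (card (pverts G)) 1)) (pverts G)"
    proof (rule bij_betw_trans[OF _ f])
      show "bij_betw fst (pverts (equal_multipartite (card (pverts G)) 1)) {..<card (pverts G)}"
        by (auto simp: bij_betw_def inj_on_def equal_multipartite_def image_iff)
    qed
    fix p q
    assume "p \<in> pverts (equal_multipartite (card (pverts G)) 1)"
      "q \<in> pverts (equal_multipartite (card (pverts G)) 1)"
    then have pq: "fst p < card (pverts G)" "fst q < card (pverts G)" "snd p = 0" "snd q = 0"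
      by (auto simp: equal_multipartite_def)
    have "f (fst p) \<in> pverts G" "f (fst q) \<in> pverts G"
      using f pq by (auto simp: bij_betw_def)
    moreover have "f (fst p) = f (fst q) \<longleftrightarrow> fst p = fst q"
      using f pq by (auto simp: bij_betw_def dest: inj_onD)
    moreover have "(v, v) \<notin> parcs G" for v using pair_no_loops by fastforce
    ultimately show "((f \<circ> fst) p, (f \<circ> fst) q) \<in> parcs G \<longleftrightarrow>
        (p, q) \<in> parcs (equal_multipartite (card (pverts G)) 1)"
      using assms pq by (auto simp: equal_multipartite_def mem_Times_iff)
  qed
qed

lemma nontrivially_hoffman_colorable_weighting:
  assumes con: "Digraph_Component.connected (with_proj G)"
    and hoff: "nontrivially_hoffman_colorable G" and gt: "lambda_min G > -2"
  obtains c k x m where "hoffman_weighting G c k x m"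
proof -
  have ne: "pverts G \<noteq> {}" using con unfolding connected_conv by auto
  define m where "m = - lambda_min G"
  define k where "k = chromatic_number G"
  obtain c where c: "proper_coloring G k c" using chromatic_number_coloring k_def by metis
  have arcs: "parcs G \<noteq> {}" and eq: "real k = 1 - lambda_max G / lambda_min G"
    and nb: "\<not> bipartite G"
    and nK: "\<And>k m. \<not> digraph_iso (with_proj (equal_multipartite k m)) (with_proj G)"
    using hoff unfolding nontrivially_hoffman_colorable_def hoffman_colorable_def k_def by auto
  have k3: "3 \<le> k" using bipartite_if_two_coloring[OF c] nb by linarith
  have psd: "0 \<le> adj_form G 1 m f f" for f
    unfolding m_def by (rule adj_form_lambda_min_nonneg[OF ne])
  have "1 < m"
  proof (rule ccontr)
    assume "\<not> 1 < m"
    \<comment> \<open>Raising the shift from m to 1 preserves nonnegativity.\<close>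
    then have "0 \<le> adj_form G 1 1 f f" for f
    proof -
      have "adj_form G 1 m f f \<le> adj_form G 1 1 f f"
        unfolding adj_form_shift[of 1 m] adj_form_shift[of 1 1]
        using \<open>\<not> 1 < m\<close> by (intro add_left_mono mult_right_mono sum_nonneg) auto
      then show ?thesis using psd[of f] by simp
    qed
    then show False
      using complete_if_psd_shift_1[OF con] complete_iso_equal_multipartite nK by blast
  qed
  obtain x where x: "\<And>v. v \<in> pverts G \<Longrightarrow> 0 < x v"
    "\<And>v. v \<in> pverts G \<Longrightarrow> (\<Sum>u\<in>nbrs G v. x u) = lambda_max G * x v"
    using lambda_max_eigenvector_pos[OF con] by blast
  have "real k * m = lambda_max G + m"
    using eq lambda_min_neg[OF arcs] unfolding m_def by (simp add: field_simps)
  note he = hoffman_equality[OF c psd x(2) this]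
  have "hoffman_weighting G c k x m"
  proof unfold_locales
    show "3 \<le> k" "1 < m" "pverts G \<noteq> {}" "m < 2" using k3 \<open>1 < m\<close> ne gt m_def by auto
    show "c v < k" if "v \<in> pverts G" for v using c that unfolding proper_coloring_def by blast
    show "c u \<noteq> c v" if "u \<in> nbrs G v" for u v
      using c that unfolding proper_coloring_def nbrs_def by fastforce
    show "(\<Sum>u | u \<in> nbrs G v \<and> c u = i. x u) = m * x v"
      if "v \<in> pverts G" "i < k" "i \<noteq> c v" for v i
      using he[OF _ _ that] k3 by simp
    show "pverts G \<subseteq> S"
      if "u \<in> S" "u \<in> pverts G" "\<And>v. v \<in> S \<Longrightarrow> nbrs G v \<subseteq> S" for S u
      using closed_under_nbrs[OF con] that by blast
  qed (use x psd in auto)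
  then show thesis by (rule that)
qed

end

section \<open>Generalized line graphs\<close>

definition edges_at :: "'a pair_pre_digraph \<Rightarrow> 'a \<Rightarrow> 'a set set" where
  "edges_at G v = {e \<in> edges G. v \<in> e}"

lemma gen_line_graph_verts[simp]:
  "Inl e \<in> pverts (gen_line_graph G a) \<longleftrightarrow> e \<in> edges G"
  "Inr (v, i, b) \<in> pverts (gen_line_graph G a) \<longleftrightarrow> v \<in> pverts G \<and> i < a v \<and> b < 2"
  by (auto simp: gen_line_graph_def line_graph_def cocktail_party_def equal_multipartite_def Let_def)

lemma gen_line_graph_nbrs[simp]:
  "Inl f \<in> nbrs (gen_line_graph G a) (Inl e) \<longleftrightarrow> e \<in> edges G \<and> f \<in> edges G \<and> e \<noteq> f \<and> e \<inter> f \<noteq> {}"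
  "Inr (v, i, b) \<in> nbrs (gen_line_graph G a) (Inl e) \<longleftrightarrow>
    e \<in> edges G \<and> v \<in> pverts G \<and> v \<in> e \<and> i < a v \<and> b < 2"
  "Inl e \<in> nbrs (gen_line_graph G a) (Inr (v, i, b)) \<longleftrightarrow>
    e \<in> edges G \<and> v \<in> pverts G \<and> v \<in> e \<and> i < a v \<and> b < 2"
  "Inr (w, j, d) \<in> nbrs (gen_line_graph G a) (Inr (v, i, b)) \<longleftrightarrow>
    w = v \<and> v \<in> pverts G \<and> i < a v \<and> j < a v \<and> i \<noteq> j \<and> b < 2 \<and> d < 2"
  by (auto simp: nbrs_def gen_line_graph_def line_graph_def cocktail_party_def
      equal_multipartite_def Let_def)

context pair_graph
begin

lemma edge_other_end:
  assumes "e \<in> edges G" "v \<in> e"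
  obtains w where "e = {v, w}" "w \<noteq> v" "v \<in> pverts G" "w \<in> pverts G"
proof -
  obtain p q where pq: "(p, q) \<in> parcs G" "e = {p, q}" using assms(1) unfolding edges_def by auto
  have "p \<noteq> q" "p \<in> pverts G" "q \<in> pverts G"
    using pq(1) pair_no_loops in_arcsD1 in_arcsD2 by fastforce+
  then show thesis using that[of q] that[of p] pq(2) assms(2) by (auto simp: insert_commute)
qed

lemma finite_edges: "finite (edges G)"
proof -
  have "edges G \<subseteq> Pow (pverts G)" using in_arcsD1 in_arcsD2 unfolding edges_def by auto
  then show ?thesis using pair_finite_verts by (simp add: finite_subset)
qed

lemma finite_edges_at[simp]: "finite (edges_at G v)"
  unfolding edges_at_def using finite_edges by simp

lemma pair_graph_gen_line_graph: "pair_graph (gen_line_graph G a)"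
proof -
  let ?L = "gen_line_graph G a"
  have V: "pverts ?L = Inl ` edges G \<union>
      Inr ` (SIGMA v : pverts G. {..<a v} \<times> {..<2})"
    by (auto simp: gen_line_graph_def line_graph_def cocktail_party_def equal_multipartite_def Let_def)
  have fin: "finite (pverts ?L)" unfolding V using finite_edges pair_finite_verts by auto
  have arcs: "(p, q) \<in> parcs ?L \<longleftrightarrow> q \<in> nbrs ?L p" for p q by (simp add: nbrs_def)
  have wf: "p \<in> pverts ?L \<and> q \<in> pverts ?L \<and> p \<noteq> q \<and> (q, p) \<in> parcs ?L" if "(p, q) \<in> parcs ?L" for p q
    using that unfolding arcs by (cases p; cases q) auto
  have sub: "parcs ?L \<subseteq> pverts ?L \<times> pverts ?L" using wf by auto
  show ?thesis
  proof unfold_locales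
    show "finite (parcs ?L)" using sub fin by (meson finite_SigmaI finite_subset)
    show "symmetric (with_proj ?L)" unfolding symmetric_def by (rule symI) (use wf in auto)
  qed (use wf fin in \<open>auto simp: split_paired_all\<close>)
qed

end

text \<open>Gaussian elimination, one equation at a time. Arbitrary finite index sets allow edges
  and petals as unknowns and root vertices as equations.\<close>

lemma homogeneous_system_nontrivial_solution:
  fixes B :: "'n \<Rightarrow> 'm \<Rightarrow> real"
  assumes "finite N" "finite M" "card N < card M"
  shows "\<exists>f. (\<exists>m\<in>M. f m \<noteq> 0) \<and> (\<forall>n\<in>N. (\<Sum>m\<in>M. B n m * f m) = 0)"
  using assms
proof (induction N arbitrary: M B rule: finite_induct)
  case empty
  then obtain m where "m \<in> M" by fastforce
  then show ?case by (intro exI[of _ "\<lambda>_. 1"]) auto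
next
  case (insert n N)
  show ?case
  proof (cases "\<forall>m\<in>M. B n m = 0")
    case True
    obtain f where "\<exists>m\<in>M. f m \<noteq> 0" "\<forall>n\<in>N. (\<Sum>m\<in>M. B n m * f m) = 0"
      using insert.IH[of M B] insert.prems insert.hyps by auto
    then show ?thesis using True by (intro exI[of _ f]) simp
  next
    case False
    then obtain p where p: "p \<in> M" "B n p \<noteq> 0" by blast
    let ?M = "M - {p}"
    define C where "C = (\<lambda>j m. B j m - B j p * B n m / B n p)"
    have "card N < card ?M" using insert.prems insert.hyps p by simp
    then obtain f where f: "\<exists>m\<in>?M. f m \<noteq> 0" "\<forall>j\<in>N. (\<Sum>m\<in>?M. C j m * f m) = 0"
      using insert.IH[of ?M C] insert.prems by auto
    define s where "s = (\<Sum>m\<in>?M. B n m * f m)"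
    define g where "g = f(p := - s / B n p)"
    have split: "(\<Sum>m\<in>M. B j m * g m) = B j p * (- s / B n p) + (\<Sum>m\<in>?M. B j m * f m)" for j
    proof -
      have "(\<Sum>m\<in>?M. B j m * g m) = (\<Sum>m\<in>?M. B j m * f m)"
        by (rule sum.cong) (auto simp: g_def)
      then show ?thesis using p insert.prems by (subst sum.remove[of M p]) (auto simp: g_def)
    qed
    have "(\<Sum>m\<in>M. B n m * g m) = 0" unfolding split using p by (simp add: s_def)
    moreover have "(\<Sum>m\<in>M. B j m * g m) = 0" if "j \<in> N" for j
    proof -
      have "(\<Sum>m\<in>?M. C j m * f m) = (\<Sum>m\<in>?M. B j m * f m - (B j p / B n p) * (B n m * f m))"
        by (rule sum.cong) (auto simp: C_def field_simps p)
      also have "\<dots> = (\<Sum>m\<in>?M. B j m * f m) - (B j p / B n p) * s"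
        unfolding s_def by (simp add: sum_subtractf sum_distrib_left)
      finally show ?thesis unfolding split using f(2) that by simp
    qed
    moreover have "\<exists>m\<in>M. g m \<noteq> 0" using f(1) by (auto simp: g_def)
    ultimately show ?thesis by blast
  qed
qed

section \<open>Color classes in a neighborhood\<close>

context hoffman_weighting
begin

lemma exists_nbr_of_color:
  assumes "v \<in> pverts X" "i < k" "i \<noteq> c v"
  obtains u where "u \<in> nbrs X v" "c u = i"
proof -
  have "(\<Sum>u | u \<in> nbrs X v \<and> c u = i. x u) \<noteq> 0"
    using weight_sum[OF assms] weight_pos[OF assms(1)] mu by simp
  then obtain u where "u \<in> nbrs X v \<and> c u = i" by (metis (mono_tags, lifting) mem_Collect_eq sum.neutral)
  then show thesis using that by blast
qed

lemma color_class_sum: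
  assumes v: "v \<in> pverts X" and S: "{u. u \<in> nbrs X v \<and> c u = c w} = S" and w: "w \<in> nbrs X v"
  shows "(\<Sum>u\<in>S. x u) = m * x v"
  using weight_sum[OF v color_less color_nbr[OF w]] w nbrs_subset unfolding S by blast

lemma single_nbr_of_color:
  assumes "v \<in> pverts X" "w \<in> nbrs X v" "\<And>u. u \<in> nbrs X v \<Longrightarrow> c u = c w \<Longrightarrow> u = w"
  shows "x w = m * x v"
proof -
  have "{u. u \<in> nbrs X v \<and> c u = c w} = {w}" using assms(2,3) by blast
  from color_class_sum[OF assms(1) this assms(2)] show ?thesis by simp
qed

lemma two_nbrs_of_color:
  assumes "v \<in> pverts X" "w \<in> nbrs X v" "w' \<in> nbrs X v" "w \<noteq> w'" "c w' = c w"
    "\<And>u. u \<in> nbrs X v \<Longrightarrow> c u = c w \<Longrightarrow> u = w \<or> u = w'"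
  shows "x w + x w' = m * x v"
proof -
  have "{u. u \<in> nbrs X v \<and> c u = c w} = {w, w'}" using assms(2,3,5,6) by blast
  from color_class_sum[OF assms(1) this assms(2)] assms(4) show ?thesis by simp
qed

end

locale gen_line_weighting =
  root: pair_graph G + hoffman_weighting "gen_line_graph G a" c k x m
  for G :: "'a pair_pre_digraph" and a c k x m
begin

abbreviation "L \<equiv> gen_line_graph G a"
abbreviation "D \<equiv> edges_at G"
abbreviation "ecol e \<equiv> c (Inl e)"
abbreviation "y e \<equiv> x (Inl e)"

lemma y_pos: "e \<in> edges G \<Longrightarrow> 0 < y e"
  by (rule weight_pos) simp

lemma D_edges: "e \<in> D v \<Longrightarrow> e \<in> edges G"
  by (simp add: edges_at_def)

lemma D_end: "e \<in> D v \<Longrightarrow> v \<in> e"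
  by (simp add: edges_at_def)

lemma D_verts: "e \<in> D v \<Longrightarrow> v \<in> pverts G"
  unfolding edges_at_def by (auto elim: root.edge_other_end)

lemma D_Int: "u \<noteq> v \<Longrightarrow> e \<in> D u \<Longrightarrow> e \<in> D v \<Longrightarrow> e = {u, v}"
  unfolding edges_at_def by (auto elim: root.edge_other_end)

text \<open>Edges at a common root vertex form a clique of the line graph.\<close>

lemma D_color_inj: "e \<in> D v \<Longrightarrow> f \<in> D v \<Longrightarrow> ecol e = ecol f \<Longrightarrow> e = f"
  using color_nbr[of "Inl f" "Inl e"] by (auto simp: edges_at_def)

section \<open>Petals, the twin pairs of the cocktail party graphs\<close>

lemma petal_nbrs_eq:
  assumes "b < 2" "d < 2"
  shows "nbrs L (Inr (v, i, b)) = nbrs L (Inr (v, i, d))"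
proof (rule Set.set_eqI)
  show "p \<in> nbrs L (Inr (v, i, b)) \<longleftrightarrow> p \<in> nbrs L (Inr (v, i, d))" for p
    using assms by (cases p) auto
qed

text \<open>If the twins had different colors, one would have a neighbor in the color of the other,
  and this is also a neighbor of the other. Their common neighborhood has the same sum in any
  further color j, hence the weights agree.\<close>

lemma petal_twins:
  assumes v: "v \<in> pverts G" "i < a v" and b: "b < 2" "d < 2"
  shows "c (Inr (v, i, b)) = c (Inr (v, i, d))" "x (Inr (v, i, b)) = x (Inr (v, i, d))"
proof -
  let ?p = "Inr (v, i, b)" and ?q = "Inr (v, i, d)"
  have V: "?p \<in> pverts L" "?q \<in> pverts L" using v b by auto
  note nb = petal_nbrs_eq[OF b]
  show c: "c ?p = c ?q"
  proof (rule ccontr)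
    assume "c ?p \<noteq> c ?q"
    then obtain u where "u \<in> nbrs L ?p" "c u = c ?q"
      using exists_nbr_of_color[OF V(1) color_less[OF V(2)]] by metis
    then show False using color_nbr nb by metis
  qed
  obtain j where j: "j < k" "j \<noteq> c ?p"
    using that[of 0] that[of 1] three_colors by (cases "c ?p = 0") auto
  have "m * x ?p = (\<Sum>u | u \<in> nbrs L ?q \<and> c u = j. x u)"
    using weight_sum[OF V(1) j] unfolding nb by (rule sym)
  also have "\<dots> = m * x ?q" using j c by (intro weight_sum[OF V(2)]) simp_all
  finally show "x ?p = x ?q" using mu by simp
qed

lemma petal_edge_color:
  assumes "e \<in> D v" "i < a v" "b < 2"
  shows "c (Inr (v, i, b)) \<noteq> ecol e"
  using color_nbr[of "Inr (v, i, b)" "Inl e"] assms D_verts[OF assms(1)] by (simp add: edges_at_def)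

text \<open>Every other neighbor of the petal vertex lies at v and is therefore adjacent to e, so e
  is its only neighbor in that color.\<close>

lemma petal_edge_weight:
  assumes e: "e \<in> D v" and p: "i < a v" "b < 2"
  shows "y e = m * x (Inr (v, i, b))"
proof (rule single_nbr_of_color)
  show "Inr (v, i, b) \<in> pverts L" using D_verts[OF e] p by simp
  show "Inl e \<in> nbrs L (Inr (v, i, b))" using e p D_verts[OF e] by (simp add: edges_at_def)
  fix u assume u: "u \<in> nbrs L (Inr (v, i, b))" "c u = ecol e"
  show "u = Inl e"
  proof (cases u)
    case (Inl f)
    then show ?thesis using u D_color_inj[OF _ e, of f] by (simp add: edges_at_def)
  next
    case (Inr q)
    then obtain j d where "q = (v, j, d)" "j < a v" "d < 2" using u(1) by (cases q) auto
    then show ?thesis using petal_edge_color[OF e] u(2) Inr by blast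
  qed
qed

text \<open>For two petals i, j at v, the twins of j are exactly the neighbors of i in their color,
  so 2 x_j = m x_i, and conversely. This gives m^2 = 4, against m < 2.\<close>

lemma petal_count_le_1:
  assumes v: "v \<in> pverts G"
  shows "a v \<le> 1"
proof (rule ccontr)
  assume "\<not> a v \<le> 1"
  then have a: "0 < a v" "1 < a v" by auto
  have *: "2 * x (Inr (v, j, 0)) = m * x (Inr (v, i, 0))" if ij: "i < a v" "j < a v" "i \<noteq> j" for i j
  proof -
    have "x (Inr (v, j, 0)) + x (Inr (v, j, 1)) = m * x (Inr (v, i, 0))"
    proof (rule two_nbrs_of_color)
      show "c (Inr (v, j, 1)) = c (Inr (v, j, 0))" using petal_twins(1)[OF v ij(2)] by simp
      fix u assume u: "u \<in> nbrs L (Inr (v, i, 0))" "c u = c (Inr (v, j, 0))"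
      show "u = Inr (v, j, 0) \<or> u = Inr (v, j, 1)"
      proof (cases u)
        case (Inl f)
        then show ?thesis using u petal_edge_color[of f v j 0] ij by (simp add: edges_at_def)
      next
        case (Inr q)
        then obtain l d where q: "q = (v, l, d)" "l < a v" "d < 2" using u(1) by (cases q) auto
        then have "l = j"
          using color_nbr[of "Inr (v, l, d)" "Inr (v, j, 0)"] u(2) Inr v ij by auto
        then show ?thesis using Inr q by auto
      qed
    qed (use v ij in auto)
    then show ?thesis using petal_twins(2)[OF v ij(2), of 0 1] by simp
  qed
  let ?p = "x (Inr (v, 0, 0))"
  have "4 * ?p = 2 * (2 * ?p)" by simp
  also have "\<dots> = m * (2 * x (Inr (v, 1, 0)))" using *[OF a(2) a(1)] by simp
  also have "\<dots> = m * m * ?p" using *[OF a(1) a(2)] by simp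
  finally have "4 * ?p = m * m * ?p" .
  moreover have "0 < ?p" by (rule weight_pos) (use v a in auto)
  moreover have "m * m < 2 * 2" using mu by (intro mult_strict_mono) auto
  ultimately show False by simp
qed

text \<open>With one petal at v, a petal vertex is adjacent to edges at v only, and these must show
  the k - 1 \<ge> 2 other colors.\<close>

lemma petal_degree:
  assumes v: "v \<in> pverts G" "0 < a v"
  shows "2 \<le> card (D v)"
proof -
  let ?p = "Inr (v, 0, 0)"
  have p: "?p \<in> pverts L" using v by simp
  have "card ({..<k} - {c ?p}) \<le> card (ecol ` D v)"
  proof (rule card_mono)
    show "{..<k} - {c ?p} \<subseteq> ecol ` D v"
    proof
      fix i assume i: "i \<in> {..<k} - {c ?p}"
      then obtain u where u: "u \<in> nbrs L ?p" "c u = i" using exists_nbr_of_color[OF p] by blast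
      show "i \<in> ecol ` D v"
      proof (cases u)
        case (Inl f)
        then show ?thesis using u by (auto simp: edges_at_def)
      next
        case (Inr q)
        then show ?thesis using u(1) petal_count_le_1[OF v(1)] by (cases q) auto
      qed
    qed
  qed simp
  also have "\<dots> \<le> card (D v)" by (rule card_image_le) simp
  finally show ?thesis using three_colors color_less[OF p] by (simp add: card_Diff_singleton)
qed

section \<open>Leaves of the root graph\<close>

lemma leaf_edge:
  assumes "D l = {{l, w}}"
  shows "{l, w} \<in> D w"
proof -
  have "{l, w} \<in> D l" using assms by simp
  then show ?thesis by (simp add: edges_at_def)
qed

text \<open>All neighbors of the pendant edge come from w and are equal or adjacent to f, so f is
  alone in its color.\<close>

lemma leaf_nbr_weight:
  assumes l: "D l = {{l, w}}" "l \<noteq> w" "a l = 0" and f: "f \<in> D w" "f \<noteq> {l, w}"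
  shows "y f = m * y {l, w}"
proof (rule single_nbr_of_color)
  have e: "{l, w} \<in> edges G" using l(1) D_edges by blast
  then show "Inl {l, w} \<in> pverts L" by simp
  show "Inl f \<in> nbrs L (Inl {l, w})" using e f by (auto simp: edges_at_def)
  fix u assume u: "u \<in> nbrs L (Inl {l, w})" "c u = ecol f"
  show "u = Inl f"
  proof (cases u)
    case (Inl g)
    then have "g \<in> D l \<or> g \<in> D w" "g \<noteq> {l, w}" using u(1) by (auto simp: edges_at_def)
    then show ?thesis using l(1) D_color_inj[OF _ f(1), of g] u(2) Inl by auto
  next
    case (Inr q)
    then obtain i d where "q = (w, i, d)" "i < a w" "d < 2" using u(1) l(3) by (cases q) auto
    then show ?thesis using petal_edge_color[OF f(1)] u(2) Inr by blast
  qed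
qed

text \<open>A petal at w would make all edges at w equally heavy, but the pendant edge is lighter
  than the others by the factor m > 1.\<close>

lemma leaf_support_petal_free:
  assumes l: "D l = {{l, w}}" "l \<noteq> w" "a l = 0"
  shows "a w = 0"
proof (rule ccontr)
  assume aw: "a w \<noteq> 0"
  note e = leaf_edge[OF l(1)]
  have "2 \<le> card (D w)" using petal_degree[OF D_verts[OF e]] aw by simp
  then have "D w \<noteq> {{l, w}}" by auto
  then obtain f where f: "f \<in> D w" "f \<noteq> {l, w}" using e by blast
  have "y f = y {l, w}" using petal_edge_weight[OF f(1), of 0 0] petal_edge_weight[OF e, of 0 0] aw by simp
  then show False using leaf_nbr_weight[OF l f] y_pos[OF D_edges[OF e]] mu by simp
qed

lemma card_D_ge:
  assumes "\<And>i. i < k \<Longrightarrow> i \<in> ecol ` D v"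
  shows "k \<le> card (D v)"
proof -
  have "card {..<k} \<le> card (ecol ` D v)" using assms by (intro card_mono) auto
  also have "\<dots> \<le> card (D v)" by (rule card_image_le) simp
  finally show ?thesis by simp
qed

text \<open>All neighbors of the pendant edge are edges at w, so every color occurs there.\<close>

lemma leaf_support_degree:
  assumes l: "D l = {{l, w}}" "l \<noteq> w" "a l = 0"
  shows "k \<le> card (D w)"
proof (rule card_D_ge)
  fix i assume i: "i < k"
  note e = leaf_edge[OF l(1)] D_edges[OF leaf_edge[OF l(1)]]
  show "i \<in> ecol ` D w"
  proof (cases "i = ecol {l, w}")
    case False
    then obtain u where u: "u \<in> nbrs L (Inl {l, w})" "c u = i"
      using exists_nbr_of_color[of "Inl {l, w}" i] e(2) i by auto
    show ?thesis
    proof (cases u)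
      case (Inl g)
      then have "g \<in> D l \<or> g \<in> D w" "g \<noteq> {l, w}" using u(1) by (auto simp: edges_at_def)
      then show ?thesis using l(1) u(2) Inl by auto
    next
      case (Inr q)
      then show ?thesis using u(1) l(3) leaf_support_petal_free[OF l] by (cases q) auto
    qed
  qed (use e in blast)
qed

text \<open>Each of two pendant edges at w would weigh m times the other, against m > 1.\<close>

lemma leaf_unique:
  assumes l: "D l = {{l, w}}" "l \<noteq> w" "a l = 0" and l': "D l' = {{l', w}}" "l' \<noteq> w" "a l' = 0"
  shows "l = l'"
proof (rule ccontr)
  assume "l \<noteq> l'"
  then have ne: "{l, w} \<noteq> {l', w}" using l(2) by (auto simp: doubleton_eq_iff)
  note e = leaf_edge[OF l(1)] leaf_edge[OF l'(1)]
  have "y {l, w} = m * (m * y {l, w})"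
    using leaf_nbr_weight[OF l e(2)] leaf_nbr_weight[OF l' e(1)] ne by metis
  moreover have "0 < y {l, w}" using y_pos[OF D_edges[OF e(1)]] .
  ultimately have "m * m = 1" by simp
  moreover have "1 * 1 < m * m" using mu by (intro mult_strict_mono) auto
  ultimately show False by simp
qed

section \<open>Counting edges, petals and root vertices\<close>

abbreviation "W \<equiv> {v \<in> pverts G. D v \<noteq> {}}"

lemma finite_W: "finite W"
  using root.pair_finite_verts by simp

text \<open>Otherwise the unsigned incidence matrix of the root graph, extended by one column for
  the two twin vertices of each petal, has a nontrivial kernel vector, and this yields an
  eigenvector of the generalized line graph for the eigenvalue \<open>-2\<close>.\<close>

lemma edges_petals_le_verts: "card (edges G) + card {v \<in> pverts G. 0 < a v} \<le> card W"
proof (rule ccontr)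
  let ?P = "{v \<in> pverts G. 0 < a v}"
  let ?M = "edges G <+> ?P"
  assume "\<not> ?thesis"
  then have "card W < card ?M"
    using root.finite_edges root.pair_finite_verts by (simp add: card_Plus)
  moreover have fM: "finite ?M" using root.finite_edges root.pair_finite_verts by simp
  \<comment> \<open>Rows are root vertices. A petal column has entry 2 because its value will be
    given to both twins.\<close>
  moreover define B :: "'a \<Rightarrow> 'a set + 'a \<Rightarrow> real" where
    "B = (\<lambda>v z. case z of Inl e \<Rightarrow> if v \<in> e then 1 else 0 | Inr w \<Rightarrow> if w = v then 2 else 0)"
  ultimately obtain h where h0: "\<exists>z\<in>?M. h z \<noteq> 0" and h1: "\<forall>v\<in>W. (\<Sum>z\<in>?M. B v z * h z) = 0"
    using homogeneous_system_nontrivial_solution[OF finite_W, of ?M B] by blast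
  define S where "S = (\<lambda>v. (\<Sum>e\<in>D v. h (Inl e)) + (if 0 < a v then 2 * h (Inr v) else 0))"
  have S0: "S v = 0" if v: "v \<in> pverts G" for v
  proof (cases "v \<in> W")
    case True
    have fP: "finite ?P" using root.pair_finite_verts by simp
    have "(\<Sum>e\<in>edges G. B v (Inl e) * h (Inl e)) = (\<Sum>e\<in>edges G. if v \<in> e then h (Inl e) else 0)"
      by (rule sum.cong) (simp_all add: B_def)
    moreover have "(\<Sum>w\<in>?P. B v (Inr w) * h (Inr w)) = (\<Sum>w\<in>?P. if w = v then 2 * h (Inr v) else 0)"
      by (rule sum.cong) (simp_all add: B_def)
    ultimately have "(\<Sum>z\<in>?M. B v z * h z) = S v"
      unfolding S_def edges_at_def sum.Plus[OF root.finite_edges fP] o_def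
      using v by (simp add: sum.inter_filter[OF root.finite_edges] sum.delta[OF fP])
    then show ?thesis using h1 True by simp
  next
    case False
    \<comment> \<open>An isolated root vertex is not a row, but it has no petal either.\<close>
    then show ?thesis using v petal_degree[of v] by (auto simp: S_def)
  qed
  define f where "f = case_sum (\<lambda>e. h (Inl e)) (\<lambda>(v, i :: nat, b :: nat). h (Inr v))"
  define T where "T = (\<lambda>v. (Inl ` D v :: ('a set + 'a \<times> nat \<times> nat) set) \<union>
    (if 0 < a v then {Inr (v, 0, 0), Inr (v, 0, 1)} else {}))"
  have fT: "finite (T v)" for v by (simp add: T_def)
  have sumD: "(\<Sum>z\<in>Inl ` D v. f z) = (\<Sum>e\<in>D v. h (Inl e))" for v
    by (subst sum.reindex) (auto simp: f_def)
  have sumT: "(\<Sum>z\<in>T v. f z) = S v" for v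
  proof (cases "0 < a v")
    case True
    have "(\<Sum>z\<in>T v. f z) = (\<Sum>z\<in>Inl ` D v. f z) + (\<Sum>z\<in>{Inr (v, 0, 0), Inr (v, 0, 1)}. f z)"
      using True unfolding T_def by (simp only: if_True) (rule sum.union_disjoint, auto)
    then show ?thesis using True unfolding sumD by (simp add: S_def f_def)
  qed (simp add: T_def S_def sumD)
  have petal: "i = 0" "b = 0 \<or> b = 1" if "v \<in> pverts G" "i < a v" "b < 2" for v i and b :: nat
    using petal_count_le_1[OF that(1)] that by auto
  have kernel: "1 * (\<Sum>u\<in>nbrs L p. f u) + 2 * f p = 0" if p: "p \<in> pverts L" for p
  proof (cases p)
    case (Inl e)
    then have e: "e \<in> edges G" using p by simp
    then obtain u where "u \<in> e" unfolding edges_def by blast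
    then obtain v where uv: "e = {u, v}" "v \<noteq> u" "u \<in> pverts G" "v \<in> pverts G"
      using root.edge_other_end[OF e] by metis
    have nb: "nbrs L p = (T u - {Inl e}) \<union> (T v - {Inl e})"
    proof (rule Set.set_eqI)
      fix z
      show "z \<in> nbrs L p \<longleftrightarrow> z \<in> (T u - {Inl e}) \<union> (T v - {Inl e})"
      proof (cases z)
        case z: (Inl g)
        show ?thesis using e unfolding z Inl T_def by (auto simp: uv(1) edges_at_def)
      next
        case z: (Inr q)
        obtain w i b where q: "q = (w, i, b)" by (cases q)
        show ?thesis using e uv(3,4) petal[of w i b] unfolding z Inl T_def q
          by (auto simp: uv(1))
      qed
    qed
    have mem: "Inl e \<in> T u" "Inl e \<in> T v" using e uv(1) by (auto simp: T_def edges_at_def)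
    have "(T u - {Inl e}) \<inter> (T v - {Inl e}) = {}"
      using D_Int[OF uv(2)[symmetric]] uv(1,2) by (auto simp: T_def)
    then have "(\<Sum>z\<in>nbrs L p. f z) = (\<Sum>z\<in>T u - {Inl e}. f z) + (\<Sum>z\<in>T v - {Inl e}. f z)"
      unfolding nb using fT by (intro sum.union_disjoint) auto
    also have "\<dots> = - 2 * f p"
      using mem fT sumT S0 uv(3,4) Inl by (simp add: sum_diff1)
    finally show ?thesis by simp
  next
    case (Inr q)
    obtain v i b where q: "q = (v, i, b)" by (cases q)
    then have v: "v \<in> pverts G" "i < a v" "b < 2" using p Inr by auto
    have nb: "nbrs L p = Inl ` D v"
    proof (rule Set.set_eqI)
      fix z
      show "z \<in> nbrs L p \<longleftrightarrow> z \<in> Inl ` D v"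
      proof (cases z)
        case z: (Inr q')
        obtain w j d where q': "q' = (w, j, d)" by (cases q')
        show ?thesis unfolding z q' Inr q using petal_count_le_1[OF v(1)] by auto
      qed (use v in \<open>auto simp: Inr q edges_at_def\<close>)
    qed
    \<comment> \<open>A petal vertex sees only the edges at v, whose values sum to -2 times its
      own.\<close>
    show ?thesis using S0[OF v(1)] v unfolding nb sumD S_def by (simp add: Inr q f_def)
  qed
  have "adj_form L 1 2 f f = 0"
    unfolding adj_form_def using kernel by (intro sum.neutral ballI) (simp only: mult_zero_right)
  \<comment> \<open>Lowering the shift from 2 to m makes the value at the nonzero vector f
    negative.\<close>
  then have "adj_form L 1 m f f = (m - 2) * (\<Sum>v\<in>pverts L. (f v)\<^sup>2)"
    unfolding adj_form_shift[of 1 2] adj_form_shift[of 1 m] by (simp add: algebra_simps)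
  moreover have "\<exists>v\<in>pverts L. f v \<noteq> 0"
  proof -
    obtain z where z: "z \<in> ?M" "h z \<noteq> 0" using h0 by (rule bexE)
    show ?thesis
    proof (cases z)
      case (Inl e)
      then show ?thesis using z by (intro bexI[of _ "Inl e"]) (auto simp: f_def)
    next
      case (Inr w)
      then show ?thesis using z by (intro bexI[of _ "Inr (w, 0, 0)"]) (auto simp: f_def)
    qed
  qed
  then have "0 < (\<Sum>v\<in>pverts L. (f v)\<^sup>2)" by (rule sum_squares_pos)
  ultimately show False using psd[of f] mu by (simp add: zero_le_mult_iff)
qed

lemma degree_sum: "(\<Sum>v\<in>W. card (D v)) = 2 * card (edges G)"
proof -
  have "(\<Sum>v\<in>W. card {e \<in> edges G. v \<in> e}) = (\<Sum>e\<in>edges G. 2)"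
  proof (rule sum_multicount_gen[OF finite_W root.finite_edges], rule ballI)
    fix e assume e: "e \<in> edges G"
    then obtain u where "u \<in> e" unfolding edges_def by blast
    then obtain v where "e = {u, v}" "v \<noteq> u" "u \<in> pverts G" "v \<in> pverts G"
      using root.edge_other_end[OF e] by metis
    moreover from this have "{w \<in> W. w \<in> e} = {u, v}" using e by (auto simp: edges_at_def)
    ultimately show "card {w \<in> W. w \<in> e} = 2" by simp
  qed
  then show ?thesis by (simp add: edges_at_def)
qed

text \<open>By the edge count, the excesses \<open>deg v + 2 a v - 2\<close> have a nonpositive sum. The excess is
  negative only at leaves, and each leaf is compensated by the vertex supporting it.\<close>

lemma petal_free_and_degrees:
  "(\<forall>v\<in>pverts G. a v = 0) \<and>
   (\<forall>v. 3 \<le> card (D v) \<longrightarrow> k = 3 \<and> card (D v) = 3 \<and> (\<exists>l. D l = {{l, v}} \<and> l \<noteq> v))"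
proof -
  define h where "h = (\<lambda>v. int (card (D v)) + 2 * int (a v) - 2)"
  define F where "F = {v \<in> W. card (D v) = 1}"
  have petal_W: "v \<in> W" if "v \<in> pverts G" "0 < a v" for v
    using petal_degree[OF that] that by auto
  have "(\<Sum>v\<in>W. a v) = (\<Sum>v\<in>W. if 0 < a v then 1 else 0)"
    using petal_count_le_1 by (intro sum.cong) force+
  also have "\<dots> = card {v \<in> W. 0 < a v}" using finite_W by (simp add: sum.inter_filter[symmetric])
  also have "{v \<in> W. 0 < a v} = {v \<in> pverts G. 0 < a v}" using petal_W by blast
  finally have petals: "(\<Sum>v\<in>W. a v) = card {v \<in> pverts G. 0 < a v}" .
  have "(\<Sum>v\<in>W. h v) = int (\<Sum>v\<in>W. card (D v)) + 2 * int (\<Sum>v\<in>W. a v) - 2 * int (card W)"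
    unfolding h_def by (simp add: sum_subtractf sum.distrib sum_distrib_left)
  then have nonpos: "(\<Sum>v\<in>W. h v) \<le> 0"
    using edges_petals_le_verts unfolding degree_sum petals by linarith
  have leaf: "\<exists>w. D l = {{l, w}} \<and> l \<noteq> w \<and> a l = 0" if l: "l \<in> F" for l
  proof -
    obtain e where e: "D l = {e}" using l card_1_singletonE unfolding F_def by blast
    then have "e \<in> edges G" "l \<in> e" by (auto simp: edges_at_def)
    then obtain w where "e = {l, w}" "w \<noteq> l" using root.edge_other_end by metis
    moreover have "a l = 0" using petal_degree[of l] l unfolding F_def by auto
    ultimately show ?thesis using e by auto
  qed
  then obtain s where s: "\<And>l. l \<in> F \<Longrightarrow> D l = {{l, s l}}" "\<And>l. l \<in> F \<Longrightarrow> l \<noteq> s l"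
    "\<And>l. l \<in> F \<Longrightarrow> a l = 0"
    by metis
  note s_deg = leaf_support_degree[OF s]
  have s_W: "s l \<in> W" if "l \<in> F" for l
    using leaf_edge[OF s(1)[OF that]] D_verts by blast
  have s_a: "a (s l) = 0" if "l \<in> F" for l
    using leaf_support_petal_free[OF s] that by blast
  have s_F: "s l \<notin> F" if "l \<in> F" for l
    using s_deg[OF that that that] three_colors unfolding F_def by simp
  \<comment> \<open>Distinct leaves are charged to distinct supports.\<close>
  have inj: "inj_on s F"
  proof (rule inj_onI)
    fix l l' assume l: "l \<in> F" "l' \<in> F" "s l = s l'"
    show "l = l'" by (rule leaf_unique[OF s(1,2,3)[OF l(1)]]) (use s[OF l(2)] l(3) in simp_all)
  qed
  let ?R = "W - (F \<union> s ` F)"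
  have fin: "finite F" "finite (s ` F)" "finite ?R" using finite_W unfolding F_def by auto
  have W_eq: "W = (F \<union> s ` F) \<union> ?R" using s_W unfolding F_def by blast
  have disj: "F \<inter> s ` F = {}" using s_F by blast
  have "(\<Sum>v\<in>W. h v) = (\<Sum>v\<in>F \<union> s ` F. h v) + (\<Sum>v\<in>?R. h v)"
    by (subst W_eq, rule sum.union_disjoint) (use fin in auto)
  also have "(\<Sum>v\<in>F \<union> s ` F. h v) = (\<Sum>l\<in>F. h l) + (\<Sum>l\<in>F. h (s l))"
    using fin disj inj by (subst sum.union_disjoint) (auto simp: sum.reindex)
  also have "\<dots> = (\<Sum>l\<in>F. h l + h (s l))" by (simp add: sum.distrib)
  finally have split: "(\<Sum>v\<in>W. h v) = (\<Sum>l\<in>F. h l + h (s l)) + (\<Sum>v\<in>?R. h v)" .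
  \<comment> \<open>The leaf has excess -1, its petal-free support the degree minus 2; that degree
    is at least k \<ge> 3.\<close>
  have pair: "h l + h (s l) = int (card (D (s l))) - 3" if "l \<in> F" for l
    using that s(3)[OF that] s_a[OF that] unfolding h_def F_def by simp
  have pair_nonneg: "0 \<le> h l + h (s l)" if "l \<in> F" for l
    using pair[OF that] s_deg[OF that that that] three_colors by simp
  \<comment> \<open>Away from the leaves the degree is at least 2, so a petal would be a strictly
    positive excess.\<close>
  have rest: "2 * int (a v) \<le> h v" if v: "v \<in> ?R" for v
  proof -
    have "card (D v) \<noteq> 0" "card (D v) \<noteq> 1" using v unfolding F_def by auto
    then show ?thesis unfolding h_def by linarith
  qed
  have rest_nonneg: "0 \<le> h v" if "v \<in> ?R" for v using rest[OF that] by linarith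
  have zero: "(\<Sum>l\<in>F. h l + h (s l)) = 0" "(\<Sum>v\<in>?R. h v) = 0"
    using sum_nonneg[of F "\<lambda>l. h l + h (s l)"] sum_nonneg[of ?R h] pair_nonneg rest_nonneg nonpos split
    by simp_all
  have F0: "\<forall>l\<in>F. h l + h (s l) = 0"
    using sum_nonneg_eq_0_iff[OF fin(1), of "\<lambda>l. h l + h (s l)"] pair_nonneg zero(1) by simp
  have R0: "\<forall>v\<in>?R. h v = 0"
    using sum_nonneg_eq_0_iff[OF fin(3) rest_nonneg] zero(2) by (rule iffD1)
  have "a v = 0" if v: "v \<in> pverts G" for v
  proof (cases "v \<in> ?R")
    case True
    then have "h v = 0" using R0 by blast
    then show ?thesis using rest[OF True] by simp
  next
    case False
    show ?thesis
    proof (rule ccontr)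
      assume "a v \<noteq> 0"
      then have "v \<in> F \<union> s ` F" using petal_W[OF v] False by blast
      then show False using s(3) s_a \<open>a v \<noteq> 0\<close> by auto
    qed
  qed
  \<comment> \<open>Positive excess puts v among the supports, and a vanishing pair sum means degree
    3; since this degree is at least k \<ge> 3, also k = 3.\<close>
  moreover have "k = 3 \<and> card (D v) = 3 \<and> (\<exists>l. D l = {{l, v}} \<and> l \<noteq> v)" if v: "3 \<le> card (D v)" for v
  proof -
    have "D v \<noteq> {}" using v by auto
    then have "v \<in> W" using D_verts by blast
    moreover have "v \<notin> F" using v unfolding F_def by simp
    moreover have "h v \<noteq> 0" using v unfolding h_def by linarith
    then have "v \<notin> ?R" using R0 by blast
    ultimately obtain l where l: "l \<in> F" "v = s l" by blast
    have "card (D v) = 3" using F0 pair[OF l(1)] l by simp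
    then show ?thesis using s_deg[OF l(1) l(1) l(1)] three_colors s(1,2)[OF l(1)] l(2) by auto
  qed
  ultimately show ?thesis by blast
qed

lemma petal_free: "v \<in> pverts G \<Longrightarrow> a v = 0"
  using petal_free_and_degrees by blast

lemma degree_3:
  assumes "3 \<le> card (D v)"
  shows "k = 3" "card (D v) = 3" "\<exists>l. D l = {{l, v}} \<and> l \<noteq> v"
  using petal_free_and_degrees assms by blast+

lemma nbrs_Inl_cases:
  assumes "z \<in> nbrs L (Inl e)"
  obtains g u where "z = Inl g" "g \<in> D u" "u \<in> e" "g \<noteq> e"
proof (cases z)
  case (Inl g)
  then show thesis using assms that by (auto simp: edges_at_def)
next
  case (Inr q)
  then show thesis using assms petal_free by (cases q) auto
qed

lemma nbrs_Inl:
  assumes "e \<in> edges G" "e = {u, v}"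
  shows "nbrs L (Inl e) = Inl ` (D u \<union> D v - {e})"
proof
  show "nbrs L (Inl e) \<subseteq> Inl ` (D u \<union> D v - {e})"
  proof
    fix z assume "z \<in> nbrs L (Inl e)"
    then obtain g t where "z = Inl g" "g \<in> D t" "t \<in> e" "g \<noteq> e" by (rule nbrs_Inl_cases)
    then show "z \<in> Inl ` (D u \<union> D v - {e})" using assms(2) by auto
  qed
  show "Inl ` (D u \<union> D v - {e}) \<subseteq> nbrs L (Inl e)"
    using assms by (auto simp: edges_at_def)
qed

section \<open>Edges of maximal weight and the shape of the root graph\<close>

definition maximal :: "'a set \<Rightarrow> bool" where
  "maximal e \<longleftrightarrow> e \<in> edges G \<and> (\<forall>f\<in>edges G. y f \<le> y e)"

text \<open>A color missing at u is supplied by a single edge g at the other end, which would then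
  weigh m y e > y e.\<close>

lemma maximal_end_degree:
  assumes e: "maximal e" "u \<in> e"
  shows "k \<le> card (D u)"
proof (rule card_D_ge, rule ccontr)
  fix i assume i: "i < k" "i \<notin> ecol ` D u"
  have eE: "e \<in> edges G" using e by (simp add: maximal_def)
  then have "e \<in> D u" using e by (simp add: edges_at_def)
  then have "i \<noteq> ecol e" using i by blast
  then obtain z where z: "z \<in> nbrs L (Inl e)" "c z = i"
    using exists_nbr_of_color[of "Inl e" i] eE i by auto
  obtain v where v: "e = {u, v}" using root.edge_other_end[OF eE e(2)] by metis
  have other: "\<exists>g \<in> D v. z = Inl g" if "z \<in> nbrs L (Inl e)" "c z = i" for z
    using that i(2) unfolding nbrs_Inl[OF eE v] by auto
  obtain g where g: "g \<in> D v" "z = Inl g" using other[OF z] by blast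
  have "x z = m * y e"
  proof (rule single_nbr_of_color[OF _ z(1)])
    fix z' assume "z' \<in> nbrs L (Inl e)" "c z' = c z"
    then obtain g' where "g' \<in> D v" "z' = Inl g'" using other z(2) by blast
    then show "z' = z" using D_color_inj g \<open>c z' = c z\<close> by blast
  qed (use eE in simp)
  moreover have "y g \<le> y e" using e g D_edges by (simp add: maximal_def)
  ultimately show False using g(2) mu y_pos[OF eE] by simp
qed

text \<open>The local picture at an end u of a maximal edge. Its symmetry in e and f lets it be
  followed around the core from one maximal edge to the next.\<close>

definition corner :: "'a set \<Rightarrow> 'a \<Rightarrow> 'a set \<Rightarrow> 'a \<Rightarrow> bool" where
  "corner e u f l \<longleftrightarrow> D u = {e, f, {u, l}} \<and> D l = {{u, l}} \<and> e \<noteq> f \<and> e \<noteq> {u, l} \<and> f \<noteq> {u, l} \<and>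
     maximal e \<and> maximal f \<and> y f = y e \<and> y e = m * y {u, l}"

lemma cornerD:
  assumes "corner e u f l"
  shows "D u = {e, f, {u, l}}" "D l = {{u, l}}" "e \<noteq> f" "e \<noteq> {u, l}" "f \<noteq> {u, l}"
    "maximal e" "maximal f" "y f = y e" "y e = m * y {u, l}"
  using assms unfolding corner_def by - (elim conjE; assumption)+

lemma corner_commute: "corner e u f l \<Longrightarrow> corner f u e l"
  unfolding corner_def by (auto simp: insert_commute)

lemma corner_card: "corner e u f l \<Longrightarrow> card (D u) = 3" "corner e u f l \<Longrightarrow> card (D l) = 1"
  unfolding corner_def by auto

text \<open>The degree bound makes u a support of degree 3 with leaf l. The edge e is not pendant,
  as its end l would have degree 1; so e and the third edge both weigh m times the pendant edge, and
  both are maximal.\<close>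

lemma maximal_corner:
  assumes e: "maximal e" "u \<in> e"
  obtains f l where "corner e u f l"
proof -
  have eE: "e \<in> edges G" using e by (simp add: maximal_def)
  have eD: "e \<in> D u" using e eE by (simp add: edges_at_def)
  have "3 \<le> card (D u)" using maximal_end_degree[OF e] three_colors by simp
  then obtain l where l: "D l = {{l, u}}" "l \<noteq> u" and card: "card (D u) = 3"
    using degree_3 by blast
  have lu: "{l, u} \<in> D u" by (rule leaf_edge[OF l(1)])
  have ne: "e \<noteq> {l, u}"
  proof
    assume "e = {l, u}"
    then show False using maximal_end_degree[OF e(1), of l] l(1) three_colors by simp
  qed
  have "card (D u - {e, {l, u}}) = 1" using card eD lu ne by (simp add: card_Diff_subset)
  then obtain f where f: "D u - {e, {l, u}} = {f}" by (rule card_1_singletonE)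
  then have fD: "f \<in> D u" "f \<noteq> e" "f \<noteq> {l, u}" by auto
  have D: "D u = {e, f, {u, l}}" using f eD lu by (auto simp: insert_commute)
  have "a l = 0" using petal_free D_verts l(1) by blast
  note w = leaf_nbr_weight[OF l this]
  have "corner e u f l"
    using D l(1) fD ne w[OF eD ne] w[OF fD(1,3)] e(1) D_edges[OF fD(1)]
    unfolding corner_def maximal_def by (auto simp: insert_commute)
  then show thesis by (rule that)
qed

lemma corner_colors:
  assumes "corner e u f l"
  shows "ecol e \<noteq> ecol f" "ecol e \<noteq> ecol {u, l}" "ecol f \<noteq> ecol {u, l}"
    "ecol e < 3" "ecol f < 3" "ecol {u, l} < 3"
proof -
  note c = assms[unfolded corner_def]
  have D: "e \<in> D u" "f \<in> D u" "{u, l} \<in> D u" using c by auto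
  show "ecol e \<noteq> ecol f" "ecol e \<noteq> ecol {u, l}" "ecol f \<noteq> ecol {u, l}"
    using D_color_inj[OF D(1,2)] D_color_inj[OF D(1,3)] D_color_inj[OF D(2,3)] c by auto
  have "k = 3" using degree_3(1)[of u] corner_card(1)[OF assms] by simp
  then show "ecol e < 3" "ecol f < 3" "ecol {u, l} < 3"
    using color_less[of "Inl e"] color_less[of "Inl f"] color_less[of "Inl {u, l}"] D[THEN D_edges]
    by simp_all
qed

lemma third_color:
  fixes i j l n :: nat
  assumes "i < 3" "j < 3" "l < 3" "n < 3" "i \<noteq> j" "i \<noteq> l" "j \<noteq> l" "n \<noteq> i" "n \<noteq> j"
  shows "n = l"
  using assms by linarith

text \<open>The four further edges at u and v share the two colors other than that of e, each of
  total weight m y e. Heavy edges f, g of one color would give m = 2, so each is paired with the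
  pendant edge at the opposite end: y e + y e / m = m y e.\<close>

lemma opposite_corners:
  assumes cu: "corner e u f p" and cv: "corner e v g q" and uv: "u \<noteq> v"
  shows "ecol f = ecol {v, q}" "ecol {u, p} = ecol g" "m * m = m + 1"
proof -
  note u = cornerD[OF cu] and v = cornerD[OF cv]
  have D: "e \<in> D u" "f \<in> D u" "{u, p} \<in> D u" "e \<in> D v" "g \<in> D v" "{v, q} \<in> D v"
    unfolding u(1) v(1) by simp_all
  have e: "e = {u, v}" using D_Int[OF uv D(1,4)] .
  have eE: "e \<in> edges G" using D D_edges by blast
  have only: "z = Inl f \<or> z = Inl {u, p} \<or> z = Inl g \<or> z = Inl {v, q}" if "z \<in> nbrs L (Inl e)" for z
    using that unfolding nbrs_Inl[OF eE e] u(1) v(1) by auto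
  have nb: "Inl f \<in> nbrs L (Inl e)" "Inl g \<in> nbrs L (Inl e)" "Inl {v, q} \<in> nbrs L (Inl e)"
    unfolding nbrs_Inl[OF eE e] using D u(3) v(3,4) by auto
  have "f \<notin> D v" using D_Int[OF uv D(2)] e u(3) by auto
  then have fg: "f \<noteq> g" "f \<noteq> {v, q}" using D by auto
  note cols = corner_colors[OF cu] corner_colors[OF cv]
  have M: "0 < y e" by (rule y_pos[OF eE])
  have gf: "ecol g \<noteq> ecol f"
  proof
    assume gf: "ecol g = ecol f"
    have "y f + y g = m * y e"
    proof (rule two_nbrs_of_color)
      show "z = Inl f \<or> z = Inl g" if "z \<in> nbrs L (Inl e)" "c z = ecol f" for z
        using only[OF that(1)] that(2) cols(3,9) gf by (elim disjE) simp_all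
    qed (use eE nb fg gf in simp_all)
    then show False using u(8) v(8) M mu by simp
  qed
  show pg: "ecol {u, p} = ecol g"
    using third_color[OF cols(4-6) cols(11) cols(1-3) cols(7)[symmetric] gf] by (rule sym)
  have "ecol {v, q} \<noteq> ecol {u, p}" unfolding pg by (rule cols(9)[symmetric])
  from third_color[OF cols(4,6,5) cols(12) cols(2,1) cols(3)[symmetric] cols(8)[symmetric] this]
  show fq: "ecol f = ecol {v, q}" by (rule sym)
  have "y f + y {v, q} = m * y e"
  proof (rule two_nbrs_of_color)
    show "z = Inl f \<or> z = Inl {v, q}" if "z \<in> nbrs L (Inl e)" "c z = ecol f" for z
      using only[OF that(1)] that(2) cols(3) pg by (elim disjE) simp_all
  qed (use eE nb fg fq in simp_all)
  then have "m * (y e + y {v, q}) = m * (m * y e)" using u(8) by simp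
  then have "(m + 1) * y e = m * m * y e" using v(9) by (simp add: algebra_simps)
  then show "m * m = m + 1" using M by simp
qed

text \<open>For \<open>m\<^sup>2 = m + 1\<close> an induced path on four vertices carries a null vector of \<open>A + m I\<close>, which
  cannot be annihilated at a pendant edge attached to the path. This makes the core a triangle.\<close>

lemma four_path_closes:
  assumes c1: "corner e1 u e0 p" and c2: "corner e1 v e2 q" and c3: "corner e2 w e3 r"
    and uv: "u \<noteq> v" and vw: "v \<noteq> w"
  shows "e3 = e0"
proof (rule ccontr)
  assume ne30: "e3 \<noteq> e0"
  note a1 = c1[unfolded corner_def] and a2 = c2[unfolded corner_def] and a3 = c3[unfolded corner_def]
  note o1 = opposite_corners[OF c1 c2 uv]
  note o2 = opposite_corners[OF corner_commute[OF c2] c3 vw]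
  note cols = corner_colors[OF c1] corner_colors[OF c2] corner_colors[OF c3]
  have D: "e0 \<in> D u" "e1 \<in> D u" "{u, p} \<in> D u" "e1 \<in> D v" "e2 \<in> D v" "{v, q} \<in> D v" "e2 \<in> D w" "e3 \<in> D w"
    using a1 a2 a3 by auto
  have e1: "e1 = {u, v}" using D_Int[OF uv] D by blast
  have e2: "e2 = {v, w}" using D_Int[OF vw] D by blast
  have E: "e0 \<in> edges G" "e1 \<in> edges G" "e2 \<in> edges G" "e3 \<in> edges G" "{u, p} \<in> edges G"
    using D D_edges by blast+
  have ypos: "0 < y {v, q}" using y_pos D_edges D by blast
  have "y e0 = m * y {v, q}" "y e3 = m * y {v, q}" using a1 a2 a3 by simp_all
  then have yne: "y e0 \<noteq> y {v, q}" "y e3 \<noteq> y {v, q}" using ypos mu by simp_all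
  \<comment> \<open>The pendant edge {v, q} is paired with e0 around e1 and with e3 around
    e2.\<close>
  have c30: "ecol e3 = ecol e0" using o1 o2 by simp
  have nD: "e0 \<notin> D w" "e0 \<notin> D v" "e3 \<notin> D u" "e3 \<notin> D v"
    using D_color_inj[OF _ D(8), of e0] D_color_inj[OF _ D(6), of e0] D_color_inj[OF _ D(1), of e3]
      D_color_inj[OF _ D(6), of e3] ne30 c30 o1(1) yne by auto
  have d: "e0 \<noteq> e1" "e0 \<noteq> e2" "e1 \<noteq> e2" "e1 \<noteq> e3" "e2 \<noteq> e3"
    using nD D a2 by auto
  have far: "e0 \<inter> e2 = {}" "e1 \<inter> e3 = {}"
    using nD E unfolding e1 e2 by (auto simp: edges_at_def)
  have far03: "e0 \<inter> e3 = {}"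
  proof (rule ccontr)
    assume "e0 \<inter> e3 \<noteq> {}"
    then have "Inl e0 \<in> nbrs L (Inl e3)" using E ne30 by auto
    then show False using color_nbr c30 by metis
  qed
  let ?S = "{Inl e0, Inl e1, Inl e2, Inl e3} :: ('a set + 'a \<times> nat \<times> nat) set"
  \<comment> \<open>On an induced path these entries give the form the value 2 m (m^2 - m -
    1).\<close>
  define f :: "'a set + 'a \<times> nat \<times> nat \<Rightarrow> real" where
    "f = (\<lambda>z. if z = Inl e0 then 1 else if z = Inl e1 then - m else if z = Inl e2 then m
       else if z = Inl e3 then -1 else 0)"
  have near: "e0 \<inter> e1 \<noteq> {}" "e1 \<inter> e2 \<noteq> {}" "e2 \<inter> e3 \<noteq> {}"
    using D by (auto simp: edges_at_def)
  have nb: "nbrs L (Inl e0) \<inter> ?S = {Inl e1}" "nbrs L (Inl e1) \<inter> ?S = {Inl e0, Inl e2}"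
    "nbrs L (Inl e2) \<inter> ?S = {Inl e1, Inl e3}" "nbrs L (Inl e3) \<inter> ?S = {Inl e2}"
    using E d near far far03 ne30 by (auto simp: Int_commute)
  have fv: "f (Inl e0) = 1" "f (Inl e1) = - m" "f (Inl e2) = m" "f (Inl e3) = -1"
    using d ne30 by (auto simp: f_def)
  have "adj_form L 1 m f f = 2 * m * (m * m) - 2 * (m * m) - 2 * m"
  proof -
    define g where "g = (\<lambda>z. \<Sum>u\<in>nbrs L z \<inter> ?S. f u)"
    have g: "g (Inl e0) = - m" "g (Inl e1) = 1 + m" "g (Inl e2) = - m - 1" "g (Inl e3) = m"
      unfolding g_def nb using d ne30 by (simp_all add: fv)
    have "adj_form L 1 m f f = 1 * (\<Sum>z\<in>?S. f z * g z) + m * (\<Sum>z\<in>?S. (f z)\<^sup>2)"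
      unfolding g_def using E by (intro adj_form_supported) (auto simp: f_def)
    then show ?thesis
      using d ne30 ne30[symmetric] by (simp add: fv g power2_eq_square algebra_simps)
  qed
  also have "\<dots> = 2 * m * (m * m - m - 1)" by (simp add: algebra_simps)
  also have "\<dots> = 0" by (simp add: o1(3))
  \<comment> \<open>The neighbors e0 and e1 of the pendant edge carry 1 and -m, so this equation
    reads 1 - m = 0.\<close>
  finally have "1 * (\<Sum>z\<in>nbrs L (Inl {u, p}). f z) + m * f (Inl {u, p}) = 0"
    using E by (intro psd_null_eigenvector[OF psd]) auto
  moreover have "nbrs L (Inl {u, p}) = {Inl e0, Inl e1}"
    unfolding nbrs_Inl[OF E(5) refl] using a1 by auto
  moreover have "f (Inl {u, p}) = 0"
  proof -
    have "{u, p} \<noteq> e2"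
    proof
      assume "{u, p} = e2"
      then have "{u, p} \<in> D v" using D(5) by simp
      then show False using D_Int[OF uv D(3)] e1 a1 by simp
    qed
    moreover have "{u, p} \<noteq> e3" using D(3) nD(3) by auto
    ultimately show ?thesis using a1 by (auto simp: f_def)
  qed
  ultimately show False using fv d mu by simp
qed

text \<open>Walk from a heaviest edge uv to vw and on to the third edge at w; it must coincide with
  the third edge at u, so it is uw. Together with the pendant edges these six are closed under
  adjacency, hence exhaust L.\<close>

lemma root_edges_net:
  obtains u v w p q r where "distinct [u, v, w, p, q, r]"
    "edges G = {{u, v}, {v, w}, {u, w}, {u, p}, {v, q}, {w, r}}"
proof -
  \<comment> \<open>L is nonempty and has no petal vertices, so the root graph has an edge.\<close>
  obtain z where z: "z \<in> pverts L" using ne by blast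
  then obtain e where "e \<in> edges G" using petal_free by (cases z) auto
  then have "edges G \<noteq> {}" by blast
  then obtain e1 where "e1 \<in> edges G" "\<And>f. f \<in> edges G \<Longrightarrow> y f \<le> y e1"
    using obtains_MAX[OF root.finite_edges, of y] by (metis Max_ge finite_imageI imageI root.finite_edges)
  then have e1: "maximal e1" "e1 \<in> edges G" by (auto simp: maximal_def)
  then obtain u where u: "u \<in> e1" unfolding edges_def by blast
  obtain v where v: "e1 = {u, v}" "v \<noteq> u" using root.edge_other_end[OF e1(2) u] by metis
  obtain e0 p where c1: "corner e1 u e0 p" using maximal_corner[OF e1(1), of u] v by auto
  obtain e2 q where c2: "corner e1 v e2 q" using maximal_corner[OF e1(1), of v] v by auto
  have e2: "maximal e2" "e2 \<in> D v" "e2 \<noteq> e1" using c2 unfolding corner_def by auto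
  obtain w where w: "e2 = {v, w}" "w \<noteq> v"
    using root.edge_other_end[OF D_edges[OF e2(2)] D_end[OF e2(2)]] by metis
  obtain e3 r where c3: "corner e2 w e3 r" using maximal_corner[OF e2(1), of w] w by auto
  have uw: "u \<noteq> w" using e2(3) w(1) v(1) by (auto simp: insert_commute)
  have "e3 = e0" using four_path_closes[OF c1 c2 c3] v(2) w(2) by blast
  then have "e0 \<in> D u" "e0 \<in> D w" using c1 c3 unfolding corner_def by auto
  then have e0: "e0 = {u, w}" using D_Int[OF uw] by blast
  have D: "D u = {{u, v}, {u, w}, {u, p}}" "D v = {{u, v}, {v, w}, {v, q}}" "D w = {{v, w}, {u, w}, {w, r}}"
    "D p = {{u, p}}" "D q = {{v, q}}" "D r = {{w, r}}"
    using c1 c2 c3 \<open>e3 = e0\<close> e0 v(1) w(1) unfolding corner_def by auto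
  let ?six = "{{u, v}, {v, w}, {u, w}, {u, p}, {v, q}, {w, r}}"
  have sub: "pverts L \<subseteq> Inl ` ?six"
  proof (rule closed)
    show "Inl e1 \<in> Inl ` ?six" "Inl e1 \<in> pverts L" using v(1) e1 by auto
    fix s :: "'a set + 'a \<times> nat \<times> nat" assume "s \<in> Inl ` ?six"
    then obtain e where e: "s = Inl e" "e \<subseteq> {u, v, w, p, q, r}" by auto
    show "nbrs L s \<subseteq> Inl ` ?six"
    proof
      fix z assume "z \<in> nbrs L s"
      then obtain g t where g: "z = Inl g" "g \<in> D t" "t \<in> e" unfolding e(1) by (rule nbrs_Inl_cases)
      then have "t \<in> {u, v, w, p, q, r}" using e(2) by blast
      then have "D t \<subseteq> ?six" by (elim insertE emptyE) (simp_all add: D)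
      from subsetD[OF this g(2)] show "z \<in> Inl ` ?six" unfolding g(1) by (rule imageI)
    qed
  qed
  have "edges G \<subseteq> ?six"
  proof
    fix e assume "e \<in> edges G"
    then have "Inl e \<in> pverts L" by simp
    from subsetD[OF sub this] show "e \<in> ?six" by (simp only: inj_image_mem_iff[OF inj_Inl])
  qed
  moreover have "?six \<subseteq> edges G"
  proof -
    have "{u, v} \<in> D u" "{v, w} \<in> D v" "{u, w} \<in> D u" "{u, p} \<in> D u" "{v, q} \<in> D v" "{w, r} \<in> D w"
      using D by simp_all
    from this[THEN D_edges] show ?thesis by (simp only: insert_subset empty_subsetI simp_thms)
  qed
  ultimately have six: "edges G = ?six" by (rule subset_antisym)
  have distinct: "distinct [u, v, w, p, q, r]"
  proof -
    have card: "card (D u) = 3" "card (D v) = 3" "card (D w) = 3" "card (D p) = 1" "card (D q) = 1" "card (D r) = 1"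
      using corner_card[OF c1] corner_card[OF c2] corner_card[OF c3] by auto
    \<comment> \<open>Degree 1 against degree 3 separates the leaves from the core.\<close>
    have "{p, q, r} \<inter> {u, v, w} = {}" using card by auto
    moreover have "p \<noteq> q" "p \<noteq> r" "q \<noteq> r"
      using D(4-6) uw v(2) w(2) by (auto simp: doubleton_eq_iff)
    ultimately show ?thesis using uw v(2) w(2) by auto
  qed
  show thesis by (rule that[OF distinct six])
qed

end

section \<open>The graph F\<close>

lemma converse_eq_swap_image: "r\<inverse> = prod.swap ` r"
  by force

lemma atLeastAtMost_1_6: "{1..6} = {1, 2, 3, 4, 5, 6 :: nat}"
  by auto

lemma graph_F_simps:
  "pverts graph_F = {1, 2, 3, 4, 5, 6}"
  "parcs graph_F = {(1,4), (1,5), (2,4), (2,6), (3,5), (3,6), (4,5), (4,6), (5,6),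
     (4,1), (5,1), (4,2), (6,2), (5,3), (6,3), (5,4), (6,4), (6,5)}"
  unfolding graph_F_def Let_def converse_eq_swap_image
  by (simp_all only: pair_pre_digraph.simps atLeastAtMost_1_6 image_insert image_empty
      Un_insert_left Un_empty_left swap_simp)

lemma pair_graph_graph_F: "pair_graph graph_F"
proof unfold_locales
  show "symmetric (with_proj graph_F)"
    unfolding symmetric_def by (rule symI) (auto simp: graph_F_simps)
qed (auto simp: graph_F_simps)

interpretation F: pair_graph graph_F by (rule pair_graph_graph_F)

lemma nbrs_graph_F:
  "nbrs graph_F 1 = {4, 5}" "nbrs graph_F 2 = {4, 6}" "nbrs graph_F 3 = {5, 6}"
  "nbrs graph_F 4 = {1, 2, 5, 6}" "nbrs graph_F 5 = {1, 3, 4, 6}" "nbrs graph_F 6 = {2, 3, 4, 5}"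
  unfolding nbrs_def graph_F_simps by auto

lemma connected_graph_F: "Digraph_Component.connected (with_proj graph_F)"
proof -
  let ?V = "pverts graph_F" and ?R = "symcl (parcs graph_F)"
  have R: "?R = parcs graph_F"
    unfolding symcl_def using F.arcs_commute by auto
  have step: "(u, v) \<in> rtrancl_on ?V ?R" if "(u, v) \<in> parcs graph_F" for u v
    by (rule rtrancl_on_into_rtrancl_on[of u u])
      (use that R F.in_arcsD1[OF that] F.in_arcsD2[OF that] in auto)
  \<comment> \<open>Vertex 4 is adjacent to all others but 3, which is reached through 5.\<close>
  have four: "(4, v) \<in> rtrancl_on ?V ?R \<and> (v, 4) \<in> rtrancl_on ?V ?R" if v: "v \<in> ?V" for v
  proof -
    have "v = 4 \<or> (4, v) \<in> parcs graph_F \<or> v = 3" using v by (auto simp: graph_F_simps)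
    moreover have "(4, 5) \<in> rtrancl_on ?V ?R" "(5, 4) \<in> rtrancl_on ?V ?R"
      "(5, 3) \<in> rtrancl_on ?V ?R" "(3, 5) \<in> rtrancl_on ?V ?R"
      by (intro step; simp add: graph_F_simps)+
    then have "(4, 3) \<in> rtrancl_on ?V ?R" "(3, 4) \<in> rtrancl_on ?V ?R"
      by (blast intro: rtrancl_on_trans)+
    moreover have "(4, 4) \<in> rtrancl_on ?V ?R" by (simp add: graph_F_simps)
    ultimately show ?thesis using step F.arcs_commute by blast
  qed
  show ?thesis
    unfolding connected_conv
    using four by (auto simp: graph_F_simps(1) intro: rtrancl_on_trans)
qed

lemma net_iso_graph_F:
  assumes G: "pair_graph G" and a: "\<And>v. v \<in> pverts G \<Longrightarrow> a v = 0"
    and d: "distinct [u, v, w, p, q, r]"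
    and E: "edges G = {{u, v}, {v, w}, {u, w}, {u, p}, {v, q}, {w, r}}"
  shows "digraph_iso (with_proj graph_F) (with_proj (gen_line_graph G a))"
proof -
  interpret G: pair_graph G by (rule G)
  let ?L = "gen_line_graph G a"
  interpret L: pair_graph ?L by (rule G.pair_graph_gen_line_graph)
  \<comment> \<open>The core edges become 4, 5, 6; the pendant edge at the common end of two of them
    becomes the vertex of F adjacent to both.\<close>
  define e :: "nat \<Rightarrow> 'a set" where
    "e = (\<lambda>i. if i = 1 then {v, q} else if i = 2 then {u, p} else if i = 3 then {w, r}
      else if i = 4 then {u, v} else if i = 5 then {v, w} else {u, w})"
  have e: "e 1 = {v, q}" "e 2 = {u, p}" "e 3 = {w, r}" "e 4 = {u, v}" "e 5 = {v, w}" "e 6 = {u, w}"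
    by (simp_all add: e_def)
  have V: "pverts ?L = Inl ` edges G"
  proof (rule Set.set_eqI)
    fix z show "z \<in> pverts ?L \<longleftrightarrow> z \<in> Inl ` edges G"
    proof (cases z)
      case (Inr t)
      then show ?thesis using a by (cases t) auto
    qed auto
  qed
  have ne: "u \<noteq> v" "u \<noteq> w" "u \<noteq> p" "u \<noteq> q" "u \<noteq> r" "v \<noteq> w" "v \<noteq> p" "v \<noteq> q" "v \<noteq> r"
    "w \<noteq> p" "w \<noteq> q" "w \<noteq> r" "p \<noteq> q" "p \<noteq> r" "q \<noteq> r"
    using d by simp_all
  have adj: "\<forall>i\<in>pverts graph_F. \<forall>j\<in>pverts graph_F.
      i \<noteq> j \<and> e i \<inter> e j \<noteq> {} \<longleftrightarrow> (i, j) \<in> parcs graph_F"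
    unfolding graph_F_simps by (simp add: e ne ne[symmetric] del: One_nat_def)
  have inj: "inj_on e {1, 2, 3, 4, 5, 6}"
    unfolding inj_on_def by (simp add: e doubleton_eq_iff ne ne[symmetric] del: One_nat_def)
  have im: "e ` {1, 2, 3, 4, 5, 6} = edges G"
  proof -
    have "{1, 2, 3, 4, 5, 6} = {4, 5, 6, 2, 1, 3 :: nat}" by auto
    then show ?thesis unfolding E by (simp only: image_insert image_empty e)
  qed
  show ?thesis
  proof (rule digraph_iso_pairI)
    show "pair_wf_digraph graph_F" "pair_wf_digraph ?L" by unfold_locales
    show "bij_betw (\<lambda>i. Inl (e i)) (pverts graph_F) (pverts ?L)"
      unfolding bij_betw_def V graph_F_simps(1)
    proof
      show "inj_on (\<lambda>i. Inl (e i)) {1, 2, 3, 4, 5, 6}"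
        using inj unfolding inj_on_def by simp
      show "(\<lambda>i. Inl (e i)) ` {1, 2, 3, 4, 5, 6} = Inl ` edges G"
        unfolding im[symmetric] by (simp add: image_image)
    qed
    fix i j assume i: "i \<in> pverts graph_F" and j: "j \<in> pverts graph_F"
    have mem: "e n \<in> edges G" if "n \<in> pverts graph_F" for n
      using that im unfolding graph_F_simps(1) by blast
    have "(Inl (e i), Inl (e j)) \<in> parcs ?L \<longleftrightarrow> Inl (e j) \<in> nbrs ?L (Inl (e i))"
      by (simp add: nbrs_def)
    also have "\<dots> \<longleftrightarrow> e i \<noteq> e j \<and> e i \<inter> e j \<noteq> {}" using mem[OF i] mem[OF j] by simp
    also have "\<dots> \<longleftrightarrow> i \<noteq> j \<and> e i \<inter> e j \<noteq> {}"
      unfolding inj_on_eq_iff[OF inj[folded graph_F_simps(1)] i j] by (rule refl)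
    also have "\<dots> \<longleftrightarrow> (i, j) \<in> parcs graph_F"
      using bspec[OF bspec[OF adj i] j] .
    finally show "(Inl (e i), Inl (e j)) \<in> parcs ?L \<longleftrightarrow> (i, j) \<in> parcs graph_F" .
  qed
qed

definition net :: "nat pair_pre_digraph" where
  "net = (let E = {(1,2), (2,3), (1,3), (1,4), (2,5), (3,6)}
    in \<lparr> pverts = {1..6}, parcs = E \<union> E\<inverse> \<rparr>)"

lemma generalized_line_graph_F: "generalized_line_graph graph_F"
proof -
  have net: "pverts net = {1, 2, 3, 4, 5, 6}"
    "parcs net = {(1,2), (2,3), (1,3), (1,4), (2,5), (3,6), (2,1), (3,2), (3,1), (4,1), (5,2), (6,3)}"
    unfolding net_def Let_def converse_eq_swap_image
    by (simp_all only: pair_pre_digraph.simps atLeastAtMost_1_6 image_insert image_empty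
        Un_insert_left Un_empty_left swap_simp)
  have G: "pair_graph net"
  proof unfold_locales
    show "symmetric (with_proj net)"
      unfolding symmetric_def by (rule symI) (auto simp: net)
  qed (auto simp: net)
  interpret G: pair_graph net by (rule G)
  have E: "edges net = {{1, 2}, {2, 3}, {1, 3}, {1, 4}, {2, 5}, {3, 6}}"
  proof
    have sw: "{2, 1} = {1, 2::nat}" "{3, 2} = {2, 3::nat}" "{3, 1} = {1, 3::nat}"
      "{4, 1} = {1, 4::nat}" "{5, 2} = {2, 5::nat}" "{6, 3} = {3, 6::nat}" by auto
    show "edges net \<subseteq> {{1, 2}, {2, 3}, {1, 3}, {1, 4}, {2, 5}, {3, 6}}"
    proof
      fix e assume "e \<in> edges net"
      then obtain u v where "(u, v) \<in> parcs net" "e = {u, v}" unfolding edges_def by blast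
      then show "e \<in> {{1, 2}, {2, 3}, {1, 3}, {1, 4}, {2, 5}, {3, 6}}"
        unfolding net(2) by (elim insertE emptyE) (simp_all add: sw del: One_nat_def)
    qed
    have "{u, v} \<in> edges net" if "(u, v) \<in> parcs net" for u v
      using that unfolding edges_def by blast
    from this[of 1 2] this[of 2 3] this[of 1 3] this[of 1 4] this[of 2 5] this[of 3 6]
    show "{{1, 2}, {2, 3}, {1, 3}, {1, 4}, {2, 5}, {3, 6}} \<subseteq> edges net"
      unfolding net(2) by simp
  qed
  have "digraph_iso (with_proj graph_F) (with_proj (gen_line_graph net (\<lambda>_. 0)))"
    by (rule net_iso_graph_F[OF G _ _ E]) simp_all
  then have "digraph_iso (with_proj (gen_line_graph net (\<lambda>_. 0))) (with_proj graph_F)"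
    by (rule digraph_iso_swap[OF F.wf_digraph_axioms])
  then show ?thesis
    unfolding generalized_line_graph_def using pair_graph_graph_F G by blast
qed

section \<open>Spectrum and coloring of F\<close>

lemma eigenvalue_graph_F_iff:
  "t \<in> adjacency_eigenvalues graph_F \<longleftrightarrow>
    (\<exists>f :: nat \<Rightarrow> real. (f 1 \<noteq> 0 \<or> f 2 \<noteq> 0 \<or> f 3 \<noteq> 0 \<or> f 4 \<noteq> 0 \<or> f 5 \<noteq> 0 \<or> f 6 \<noteq> 0) \<and>
      f 4 + f 5 = t * f 1 \<and> f 4 + f 6 = t * f 2 \<and> f 5 + f 6 = t * f 3 \<and>
      f 1 + f 2 + f 5 + f 6 = t * f 4 \<and> f 1 + f 3 + f 4 + f 6 = t * f 5 \<and>
      f 2 + f 3 + f 4 + f 5 = t * f 6)"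
  unfolding F.adjacency_eigenvalues_iff graph_F_simps(1) by (simp add: nbrs_graph_F add.assoc del: One_nat_def)

text \<open>Multiplying the equations at the core 4, 5, 6 by t eliminates the values at 1, 2, 3.
  With T the sum over the core this gives (t^2 - 2 t - 4) T = 0 and (t^2 + t - 1) f_i = (t + 1) T
  for i in the core. If neither factor vanishes, f is zero on the core and then everywhere.\<close>

lemma eigenvalue_graph_F_root:
  assumes "t \<in> adjacency_eigenvalues graph_F"
  shows "t * t = 2 * t + 4 \<or> t * t = 1 - t"
proof (rule ccontr)
  assume neg: "\<not> ?thesis"
  obtain f :: "nat \<Rightarrow> real" where
    nz: "f 1 \<noteq> 0 \<or> f 2 \<noteq> 0 \<or> f 3 \<noteq> 0 \<or> f 4 \<noteq> 0 \<or> f 5 \<noteq> 0 \<or> f 6 \<noteq> 0"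
    and f: "f 4 + f 5 = t * f 1" "f 4 + f 6 = t * f 2" "f 5 + f 6 = t * f 3"
      "f 1 + f 2 + f 5 + f 6 = t * f 4" "f 1 + f 3 + f 4 + f 6 = t * f 5" "f 2 + f 3 + f 4 + f 5 = t * f 6"
    using assms unfolding eigenvalue_graph_F_iff by blast
  let ?T = "f 4 + f 5 + f 6"
  have q: "t * (t * f 4) = t * f 1 + t * f 2 + t * f 5 + t * f 6"
    "t * (t * f 5) = t * f 1 + t * f 3 + t * f 4 + t * f 6"
    "t * (t * f 6) = t * f 2 + t * f 3 + t * f 4 + t * f 5"
    by (simp_all only: f(4-6)[symmetric] distrib_left)
  have "(t * t - 2 * t - 4) * ?T = t * (t * f 4) + t * (t * f 5) + t * (t * f 6)
      - 2 * (t * f 4 + t * f 5 + t * f 6) - 4 * ?T"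
    by (simp add: algebra_simps)
  also have "\<dots> = 0" unfolding q f(1-3)[symmetric] by (simp add: algebra_simps)
  finally have T: "?T = 0" using neg by auto
  then have "t * ?T = 0" by simp
  then have tT: "t * f 4 + t * f 5 + t * f 6 = 0" by (simp only: distrib_left)
  have expand: "(t * t + t - 1) * f i = t * (t * f i) + t * f i - f i" for i
    by (simp add: algebra_simps)
  have "(t * t + t - 1) * f 4 = ?T + (t * f 4 + t * f 5 + t * f 6)"
    "(t * t + t - 1) * f 5 = ?T + (t * f 4 + t * f 5 + t * f 6)"
    "(t * t + t - 1) * f 6 = ?T + (t * f 4 + t * f 5 + t * f 6)"
    unfolding expand q f(1-3)[symmetric] by simp_all
  then have "(t * t + t - 1) * f 4 = 0" "(t * t + t - 1) * f 5 = 0" "(t * t + t - 1) * f 6 = 0"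
    using T tT by simp_all
  then have f456: "f 4 = 0" "f 5 = 0" "f 6 = 0" using neg by auto
  then have "f 1 = 0" "f 2 = 0" "f 3 = 0" using f by auto
  then show False using nz f456 by blast
qed

lemma lambda_graph_F: "lambda_max graph_F = 1 + sqrt 5" "lambda_min graph_F = - (1 + sqrt 5) / 2"
proof -
  let ?s = "sqrt 5"
  have ss: "?s * ?s = 5" by simp
  have "2 < ?s" by (rule real_less_rsqrt) simp
  moreover have "?s < 3" by (rule real_less_lsqrt) simp_all
  ultimately have s2: "2 < ?s" "?s < 3" by blast+
  have bounds: "- (1 + ?s) / 2 \<le> t" "t \<le> 1 + ?s" if t: "t \<in> adjacency_eigenvalues graph_F" for t
  proof -
    have "t = 1 + ?s \<or> t = 1 - ?s \<or> t = (- 1 + ?s) / 2 \<or> t = - (1 + ?s) / 2"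
      using eigenvalue_graph_F_root[OF t]
    proof
      assume "t * t = 2 * t + 4"
      then have "(t - (1 + ?s)) * (t - (1 - ?s)) = 0" using ss by (simp add: algebra_simps)
      then show ?thesis by auto
    next
      assume "t * t = 1 - t"
      then have "(2 * t - (- 1 + ?s)) * (2 * t + (1 + ?s)) = 0" using ss by (simp add: algebra_simps)
      then show ?thesis by auto
    qed
    then show "- (1 + ?s) / 2 \<le> t" "t \<le> 1 + ?s" using s2 by auto
  qed
  \<comment> \<open>The Perron vector, constant on the core 4, 5, 6 and on 1, 2, 3.\<close>
  define g :: "nat \<Rightarrow> real" where "g = (\<lambda>i. if i \<le> 3 then 2 else 1 + ?s)"
  have "1 + ?s \<in> adjacency_eigenvalues graph_F"
    unfolding eigenvalue_graph_F_iff
    by (rule exI[of _ g]) (use ss in \<open>simp add: g_def algebra_simps\<close>)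
  then show "lambda_max graph_F = 1 + ?s"
    unfolding lambda_max_def using bounds by (intro Max_eqI F.finite_adjacency_eigenvalues) auto
  \<comment> \<open>Core values 2, -2, 0 with sum zero; the values at 1, 2, 3 follow on dividing by
    t.\<close>
  define h :: "nat \<Rightarrow> real" where
    "h = (\<lambda>i. if i = 2 then 1 - ?s else if i = 3 then ?s - 1 else if i = 4 then 2 else if i = 5 then - 2 else 0)"
  have "- (1 + ?s) / 2 \<in> adjacency_eigenvalues graph_F"
    unfolding eigenvalue_graph_F_iff
    by (rule exI[of _ h]) (use ss in \<open>simp add: h_def field_simps\<close>)
  then show "lambda_min graph_F = - (1 + ?s) / 2"
    unfolding lambda_min_def using bounds by (intro Min_eqI F.finite_adjacency_eigenvalues) auto
qed

lemma lambda_min_graph_F_gt: "lambda_min graph_F > -2"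
proof -
  have "sqrt 5 < 3" by (rule real_less_lsqrt) simp_all
  then show ?thesis unfolding lambda_graph_F by simp
qed

lemma not_bipartite_graph_F: "\<not> bipartite graph_F"
proof
  assume "bipartite graph_F"
  then obtain A B where AB: "A \<inter> B = {}" "parcs graph_F \<subseteq> A \<times> B \<union> B \<times> A"
    unfolding bipartite_def by blast
  have "(4, 5) \<in> parcs graph_F" "(5, 6) \<in> parcs graph_F" "(4, 6) \<in> parcs graph_F"
    by (simp_all add: graph_F_simps)
  then have "(4, 5) \<in> A \<times> B \<union> B \<times> A" "(5, 6) \<in> A \<times> B \<union> B \<times> A" "(4, 6) \<in> A \<times> B \<union> B \<times> A"
    using AB(2) by blast+
  then show False using AB(1) by auto
qed

lemma chromatic_number_graph_F: "chromatic_number graph_F = 3"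
proof -
  \<comment> \<open>The triangle 4, 5, 6 gets three colors, and each of 1, 2, 3 the color of the
    triangle vertex not adjacent to it.\<close>
  define c :: "nat \<Rightarrow> nat" where "c = (\<lambda>i. if i = 1 \<or> i = 6 then 0 else if i = 2 \<or> i = 5 then 1 else 2)"
  have "proper_coloring graph_F 3 c"
    unfolding proper_coloring_def graph_F_simps c_def by simp
  then have "\<exists>c. proper_coloring graph_F 3 c" by blast
  moreover have "3 \<le> k" if "\<exists>c. proper_coloring graph_F k c" for k
    using that F.bipartite_if_two_coloring[of k] not_bipartite_graph_F by force
  ultimately show ?thesis
    unfolding chromatic_number_def by (intro Least_equality) auto
qed

text \<open>The extreme eigenvalues have quotient -2, so Hoffman's value is 3. In a complete
  multipartite graph non-adjacency is transitive; in F the vertices 2 and 6 are adjacent although 1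
  is adjacent to neither.\<close>

lemma nontrivially_hoffman_colorable_graph_F: "nontrivially_hoffman_colorable graph_F"
proof -
  have "0 < 1 + sqrt 5" by (simp add: add_pos_pos)
  then have "hoffman_colorable graph_F"
    unfolding hoffman_colorable_def chromatic_number_graph_F lambda_graph_F
    by (simp add: graph_F_simps field_simps)
  moreover have "\<not> digraph_iso (with_proj (equal_multipartite k n)) (with_proj graph_F)" for k n
  proof
    assume "digraph_iso (with_proj (equal_multipartite k n)) (with_proj graph_F)"
    then obtain h where h: "bij_betw h (pverts (equal_multipartite k n)) (pverts graph_F)"
      and adj: "\<And>u v. u \<in> pverts (equal_multipartite k n) \<Longrightarrow> v \<in> pverts (equal_multipartite k n) \<Longrightarrow>
        (h u, h v) \<in> parcs graph_F \<longleftrightarrow> (u, v) \<in> parcs (equal_multipartite k n)"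
      by (rule digraph_iso_pairE) (rule that, blast+)
    have "\<exists>x \<in> pverts (equal_multipartite k n). h x = i" if "i \<in> {1, 2, 6}" for i
    proof -
      have "i \<in> h ` pverts (equal_multipartite k n)"
        using that h unfolding bij_betw_def by (auto simp: graph_F_simps)
      then show ?thesis by blast
    qed
    from this[of 1] this[of 2] this[of 6]
    obtain x1 x2 x6 where x: "x1 \<in> pverts (equal_multipartite k n)" "h x1 = 1"
      "x2 \<in> pverts (equal_multipartite k n)" "h x2 = 2"
      "x6 \<in> pverts (equal_multipartite k n)" "h x6 = 6"
      by auto
    have "(x1, x2) \<notin> parcs (equal_multipartite k n)" "(x1, x6) \<notin> parcs (equal_multipartite k n)"
      "(x2, x6) \<in> parcs (equal_multipartite k n)"
      using adj[OF x(1,3)] adj[OF x(1,5)] adj[OF x(3,5)] x by (simp_all add: graph_F_simps)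
    then show False using x(1,3,5) unfolding equal_multipartite_def by auto
  qed
  ultimately show ?thesis
    unfolding nontrivially_hoffman_colorable_def using not_bipartite_graph_F by blast
qed

lemma line_graph_iso_petal_free:
  assumes G: "pair_graph G" and a: "\<And>v. v \<in> pverts G \<Longrightarrow> a v = 0"
  shows "digraph_iso (with_proj (line_graph G)) (with_proj (gen_line_graph G a))"
proof (rule digraph_iso_pairI[where h = Inl])
  interpret G: pair_graph G by (rule G)
  interpret L: pair_graph "gen_line_graph G a" by (rule G.pair_graph_gen_line_graph)
  show "pair_wf_digraph (line_graph G)" by unfold_locales (auto simp: line_graph_def)
  show "pair_wf_digraph (gen_line_graph G a)" by unfold_locales
  show "bij_betw Inl (pverts (line_graph G)) (pverts (gen_line_graph G a))"
    unfolding bij_betw_def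
  proof
    show "Inl ` pverts (line_graph G) = pverts (gen_line_graph G a)"
      using a by (auto simp: gen_line_graph_def cocktail_party_def equal_multipartite_def Let_def)
  qed simp
qed (auto simp: gen_line_graph_def Let_def)

theorem mainTheorem4:
  shows
    "(\<forall>(G :: 'a pair_pre_digraph) (a :: 'a \<Rightarrow> nat).
        pair_graph G \<and>
        Digraph_Component.connected (with_proj (gen_line_graph G a)) \<and>
        nontrivially_hoffman_colorable (gen_line_graph G a) \<and>
        lambda_min (gen_line_graph G a) > -2
        \<longrightarrow> (\<forall>v \<in> pverts G. a v = 0) \<and>
            digraph_iso (with_proj (line_graph G)) (with_proj (gen_line_graph G a))) \<and>
     (generalized_line_graph graph_F \<and>
      Digraph_Component.connected (with_proj graph_F) \<and>
      nontrivially_hoffman_colorable graph_F \<and>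
      lambda_min graph_F > -2) \<and>
     (\<forall>X :: 'b pair_pre_digraph.
        generalized_line_graph X \<and>
        Digraph_Component.connected (with_proj X) \<and>
        nontrivially_hoffman_colorable X \<and>
        lambda_min X > -2
        \<longrightarrow> digraph_iso (with_proj graph_F) (with_proj X))"
proof (intro conjI allI impI; (elim conjE)?)
  fix G :: "'a pair_pre_digraph" and a :: "'a \<Rightarrow> nat"
  assume G: "pair_graph G" and L: "Digraph_Component.connected (with_proj (gen_line_graph G a))"
    "nontrivially_hoffman_colorable (gen_line_graph G a)" "lambda_min (gen_line_graph G a) > -2"
  interpret G: pair_graph G by (rule G)
  interpret L: pair_graph "gen_line_graph G a" by (rule G.pair_graph_gen_line_graph)
  obtain c k x m where "hoffman_weighting (gen_line_graph G a) c k x m"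
    using L.nontrivially_hoffman_colorable_weighting[OF L] by blast
  then interpret W: gen_line_weighting G a c k x m
    unfolding gen_line_weighting_def using G by blast
  show "\<forall>v\<in>pverts G. a v = 0" using W.petal_free by blast
  then show "digraph_iso (with_proj (line_graph G)) (with_proj (gen_line_graph G a))"
    by (intro line_graph_iso_petal_free G) blast
next
  fix X :: "'b pair_pre_digraph"
  assume "generalized_line_graph X" and X: "Digraph_Component.connected (with_proj X)"
    "nontrivially_hoffman_colorable X" "lambda_min X > -2"
  then obtain H :: "nat pair_pre_digraph" and a where pg: "pair_graph X" "pair_graph H"
    and iso: "digraph_iso (with_proj (gen_line_graph H a)) (with_proj X)"
    unfolding generalized_line_graph_def by blast
  interpret X: pair_graph X by (rule pg(1))
  interpret H: pair_graph H by (rule pg(2))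
  obtain c k x m where W: "hoffman_weighting X c k x m"
    using X.nontrivially_hoffman_colorable_weighting[OF X] by blast
  obtain h where h: "bij_betw h (pverts (gen_line_graph H a)) (pverts X)"
    "\<And>u v. u \<in> pverts (gen_line_graph H a) \<Longrightarrow> v \<in> pverts (gen_line_graph H a) \<Longrightarrow>
      (h u, h v) \<in> parcs X \<longleftrightarrow> (u, v) \<in> parcs (gen_line_graph H a)"
    using iso by (rule digraph_iso_pairE) (rule that, blast+)
  have "hoffman_weighting (gen_line_graph H a) (c \<circ> h) k (x \<circ> h) m"
    by (rule hoffman_weighting_iso[OF W H.pair_graph_gen_line_graph h])
  then interpret W: gen_line_weighting H a "c \<circ> h" k "x \<circ> h" m
    unfolding gen_line_weighting_def using pg(2) by blast
  obtain u v w p q r where net: "distinct [u, v, w, p, q, r]"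
    "edges H = {{u, v}, {v, w}, {u, w}, {u, p}, {v, q}, {w, r}}"
    by (rule W.root_edges_net)
  have "digraph_iso (with_proj graph_F) (with_proj (gen_line_graph H a))"
    by (rule net_iso_graph_F[OF pg(2) W.petal_free net])
  then show "digraph_iso (with_proj graph_F) (with_proj X)"
    using iso by (rule digraph_iso_trans)
qed (fact generalized_line_graph_F connected_graph_F nontrivially_hoffman_colorable_graph_F
    lambda_min_graph_F_gt)+

end
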